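(* Let $\alpha\ge 0$, $\gamma\geq 0$ and $\delta>0$, and let $\mu\geq 0$, $\nu\geq 0$ be real numbers with $\mu\nu=\gamma$ and $\mu+\nu=\alpha-\gamma$. Let $\lambda:[0,1]\to\mathbb{R}$ be a non-negative integrable function with $\int_0^1\lambda(t)\,dt=1$. Let $\xi<1$ and let $\beta<1$ be defined by $$\frac{\beta}{1-\beta}=-\int_0^1\lambda(t)\,\frac{1-\frac{1+\xi}{1-\xi}\,t}{1+t}\,dt.$$ Then for every $f\in\mathcal{W}_\beta^\delta(\alpha,\gamma)$, the function $V_\lambda^\delta(f)$ belongs to $\mathcal{W}_\xi^\delta(\alpha,\gamma)$. The value of $\beta$ is sharp.
   Context: Let $\mathbb{D}=\{z\in\mathbb{C}:|z|<1\}$ and let $\mathcal{A}$ be the class of analytic functions $f$ on $\mathbb{D}$ of the form $f(z)=z+\sum_{n=2}^\infty a_nz^n$. All powers are principal values. For $\alpha\ge0$, $\beta<1$, $\gamma\ge 0$, $\delta>0$, the class $\mathcal{W}_\beta^\delta(\alpha,\gamma)$ consists of all $f\in\mathcal{A}$ for which there is some $\phi\in\mathbb{R}$ such that $\mathrm{Re}\,e^{i\phi}(H_f(z)-\beta)>0$ for all $z\in\mathbb{D}$, where $$H_f(z)=(1-\alpha+2\gamma)\left(\frac{f}{z}\right)^\delta+\left(\alpha-3\gamma+\gamma\left[\left(1-\frac1\delta\right)\frac{zf'}{f}+\frac1\delta\left(1+\frac{zf''}{f'}\right)\right]\right)\left(\frac{f}{z}\right)^\delta\frac{zf'}{f}.$$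 For a non-negative integrable $\lambda$ on $[0,1]$ with $\int_0^1\lambda=1$ and $f\in\mathcal{A}$, $$V_\lambda^\delta(f)(z)=\left(\int_0^1\lambda(t)\left(\frac{f(tz)}{t}\right)^\delta dt\right)^{1/\delta},\qquad z\in\mathbb{D}.$$ "The value of $\beta$ is sharp" means that $\beta$ cannot be replaced by any smaller number: for $\beta'<\beta$ the implication $f\in\mathcal{W}_{\beta'}^\delta(\alpha,\gamma)\Rightarrow V_\lambda^\delta(f)\in\mathcal{W}_\xi^\delta(\alpha,\gamma)$ fails.
   Formalization: The inclusion is stated for f whose transform V(f) is analytic (the 1/δ power exists); sharpness is stated when, for some β0<β, all local solutions have a 1/δ power (as for 1/δ natural or β>0). Both are also proved unconditionally for f defined only near 0. *)

theory Defs
  imports "HOL-Complex_Analysis.Complex_Analysis"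
begin

abbreviation unit_disk :: "complex set" where
  "unit_disk \<equiv> ball 0 1"

definition class_A :: "(complex \<Rightarrow> complex) set" where
  "class_A = {f. f holomorphic_on unit_disk \<and> f 0 = 0 \<and> deriv f 0 = 1}"

text \<open>
  Powers are only taken of functions \<open>h\<close> that tend to 1 at the origin.  The principal value of
  \<open>h\<close> to the power \<open>s\<close> is then analytic near the origin, and in the disk the power denotes the
  analytic function that continues it; it is \<open>h powr s\<close> itself wherever \<open>h\<close> has not crossed the
  cut.  Such a function exists if \<open>h\<close> has no zeros or if \<open>s\<close> is a natural number (lemmas below),
  but in general not if \<open>h\<close> has zeros.  The filter \<open>at 0\<close> leaves out the origin because
  \<open>f z / z\<close> has the value 0 there.
\<close>

definition is_power :: "real \<Rightarrow> (complex \<Rightarrow> complex) \<Rightarrow> (complex \<Rightarrow> complex) \<Rightarrow> bool" where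
  "is_power s h p \<longleftrightarrow>
     p holomorphic_on unit_disk \<and> (\<forall>\<^sub>F z in at 0. p z = h z powr of_real s)"

definition has_power :: "real \<Rightarrow> (complex \<Rightarrow> complex) \<Rightarrow> bool" where
  "has_power s h \<longleftrightarrow> (\<exists>p. is_power s h p)"

text \<open>By the identity theorem the choice is unique on the disk.\<close>

definition fun_power :: "real \<Rightarrow> (complex \<Rightarrow> complex) \<Rightarrow> complex \<Rightarrow> complex" where
  "fun_power s h = (SOME p. is_power s h p)"

text \<open>The expression \<open>H\<^sub>f\<close>, with \<open>g\<close> standing for the power \<open>\<delta>\<close> of \<open>f z / z\<close>.\<close>

definition H_expr ::
    "real \<Rightarrow> real \<Rightarrow> real \<Rightarrow> (complex \<Rightarrow> complex) \<Rightarrow> (complex \<Rightarrow> complex) \<Rightarrow> complex \<Rightarrow> complex" where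
  "H_expr \<alpha> \<gamma> \<delta> f g z =
     of_real (1 - \<alpha> + 2 * \<gamma>) * g z
     + (of_real (\<alpha> - 3 * \<gamma>)
        + of_real \<gamma> * (of_real (1 - 1 / \<delta>) * (z * deriv f z / f z)
                       + of_real (1 / \<delta>) * (1 + z * (deriv ^^ 2) f z / deriv f z)))
       * g z * (z * deriv f z / f z)"

text \<open>
  The quotients in the expression are 0/0 at the origin and break down at zeros of \<open>f\<close> and \<open>f'\<close>,
  but the expression as a whole has only removable singularities in the disk.
\<close>

definition H_fun :: "real \<Rightarrow> real \<Rightarrow> real \<Rightarrow> (complex \<Rightarrow> complex) \<Rightarrow> complex \<Rightarrow> complex" where
  "H_fun \<alpha> \<gamma> \<delta> f = remove_sings (H_expr \<alpha> \<gamma> \<delta> f (fun_power \<delta> (\<lambda>z. f z / z)))"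

definition class_W :: "real \<Rightarrow> real \<Rightarrow> real \<Rightarrow> real \<Rightarrow> (complex \<Rightarrow> complex) set" where
  "class_W \<alpha> \<gamma> \<delta> \<beta> =
     {f \<in> class_A. has_power \<delta> (\<lambda>z. f z / z) \<and>
        (\<exists>\<phi>::real. \<forall>z\<in>unit_disk.
           Re (exp (\<i> * of_real \<phi>) * (H_fun \<alpha> \<gamma> \<delta> f z - of_real \<beta>)) > 0)}"

definition mean_op :: "(real \<Rightarrow> real) \<Rightarrow> (complex \<Rightarrow> complex) \<Rightarrow> complex \<Rightarrow> complex" where
  "mean_op lam g z = integral {0..1} (\<lambda>t. of_real (lam t) * g (of_real t * z))"

text \<open>
  The power \<open>\<delta>\<close> of \<open>f(tz)/t\<close> is the power \<open>\<delta>\<close> of \<open>z\<close> times that of \<open>f(tz)/(tz)\<close>.  The factor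
  depending on \<open>z\<close> alone is taken out of the integral, so that both remaining powers have bases
  tending to 1 at the origin.
\<close>

definition V_base :: "(real \<Rightarrow> real) \<Rightarrow> real \<Rightarrow> (complex \<Rightarrow> complex) \<Rightarrow> complex \<Rightarrow> complex" where
  "V_base lam \<delta> f = mean_op lam (fun_power \<delta> (\<lambda>z. f z / z))"

definition V_op :: "(real \<Rightarrow> real) \<Rightarrow> real \<Rightarrow> (complex \<Rightarrow> complex) \<Rightarrow> complex \<Rightarrow> complex" where
  "V_op lam \<delta> f z = z * fun_power (1 / \<delta>) (V_base lam \<delta> f) z"

text \<open>
  The integral transform is a function in the disk only if the outer power exists.
\<close>

definition V_defined :: "(real \<Rightarrow> real) \<Rightarrow> real \<Rightarrow> (complex \<Rightarrow> complex) \<Rightarrow> bool" where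
  "V_defined lam \<delta> f \<longleftrightarrow> has_power (1 / \<delta>) (V_base lam \<delta> f)"

text \<open>
  The same class without the demand that \<open>f\<close> be single-valued in the disk.  It is described by
  \<open>g\<close>, the power \<open>\<delta>\<close> of \<open>f z / z\<close>; \<open>f\<close> itself is \<open>z * g z powr (1 / \<delta>)\<close> near the origin, and
  \<open>h\<close> is the continuation of \<open>H\<^sub>f\<close> to the disk.  In terms of \<open>g\<close> the integral transform is
  \<open>mean_op lam\<close>.
\<close>

definition class_W_local :: "real \<Rightarrow> real \<Rightarrow> real \<Rightarrow> real \<Rightarrow> (complex \<Rightarrow> complex) set" where
  "class_W_local \<alpha> \<gamma> \<delta> \<beta> =
     {g. g holomorphic_on unit_disk \<and> g 0 = 1 \<and>
        (\<exists>h. h holomorphic_on unit_disk \<and>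
           (\<forall>\<^sub>F z in at 0. h z = H_expr \<alpha> \<gamma> \<delta> (\<lambda>w. w * g w powr of_real (1 / \<delta>)) g z) \<and>
           (\<exists>\<phi>::real. \<forall>z\<in>unit_disk. Re (exp (\<i> * of_real \<phi>) * (h z - of_real \<beta>)) > 0))}"

lemma has_power_of_nat:
  assumes "h holomorphic_on unit_disk" "h 0 = 1"
  shows "has_power (real n) h"
proof -
  have "isCont h 0"
    using assms(1) by (metis centre_in_ball continuous_on_interior holomorphic_on_imp_continuous_on
        interior_open open_ball zero_less_one)
  then have "\<forall>\<^sub>F z in at 0. h z \<noteq> 0"
    using assms(2) tendsto_imp_eventually_ne[of h 1 "at 0" 0] by (simp add: isCont_def)
  then have "\<forall>\<^sub>F z in at 0. h z ^ n = h z powr of_real (real n)"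
    by eventually_elim (simp add: powr_nat')
  then have "is_power (real n) h (\<lambda>z. h z ^ n)"
    using assms(1) by (auto simp: is_power_def intro!: holomorphic_intros)
  then show ?thesis by (auto simp: has_power_def)
qed

lemma has_power_of_nonzero:
  assumes "h holomorphic_on unit_disk" "h 0 = 1" "\<And>z. z \<in> unit_disk \<Longrightarrow> h z \<noteq> 0"
  shows "has_power s h"
proof -
  obtain l where l: "l holomorphic_on unit_disk" "\<And>z. z \<in> unit_disk \<Longrightarrow> h z = exp (l z)"
    using contractible_imp_holomorphic_log[OF assms(1) convex_imp_contractible[OF convex_ball]] assms(3)
    by blast
  define m where "m = (\<lambda>z. l z - l 0)"
  have m: "m holomorphic_on unit_disk" "m 0 = 0"
    using l(1) by (auto simp: m_def intro!: holomorphic_intros)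
  have hm: "h z = exp (m z)" if "z \<in> unit_disk" for z
    using l(2)[OF that] l(2)[of 0] assms(2) by (simp add: m_def exp_diff)
  have "isCont m 0"
    using m(1) by (metis centre_in_ball continuous_on_interior holomorphic_on_imp_continuous_on
        interior_open open_ball zero_less_one)
  then have "(m \<longlongrightarrow> 0) (at 0)"
    using m(2) by (simp add: isCont_def)
  then have "\<forall>\<^sub>F z in at 0. dist (m z) 0 < 1"
    by (rule tendstoD) simp
  moreover have "\<forall>\<^sub>F z in at (0::complex). z \<in> unit_disk"
    by (rule eventually_at_in_open') auto
  ultimately have "\<forall>\<^sub>F z in at 0. exp (of_real s * m z) = h z powr of_real s"
  proof eventually_elim
    case (elim z)
    have "\<bar>Im (m z)\<bar> < 1"
      using elim(1) abs_Im_le_cmod[of "m z"] by (simp add: dist_norm)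
    then have "Ln (exp (m z)) = m z"
      using pi_gt3 by (intro Ln_exp) auto
    then show ?case
      using hm[OF elim(2)] by (simp add: powr_def)
  qed
  then have "is_power s h (\<lambda>z. exp (of_real s * m z))"
    using m(1) by (auto simp: is_power_def intro!: holomorphic_intros)
  then show ?thesis by (auto simp: has_power_def)
qed

end

theory Submission
  imports Defs
begin

text \<open>
  Put \<open>g = (f z / z)\<close> to the power \<open>\<delta>\<close> and let \<open>\<theta>\<close> be the operator \<open>z d/dz\<close>.  The expression
  \<open>H\<^sub>f\<close>, nonlinear in \<open>f\<close>, is linear in \<open>g\<close> (lemma \<open>H_expr_eq_H_lin\<close>):
  \<open>H\<^sub>f = (1 + \<mu> \<theta> / \<delta>) (1 + \<nu> \<theta> / \<delta>) g\<close>.  It multiplies the coefficients of \<open>g\<close> by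
  constants.  The integral transform, read on \<open>g\<close>, replaces \<open>g z\<close> by the mean of \<open>g (t z)\<close> and
  also acts on coefficients, so the two operators commute (\<open>H_lin_mean_op\<close>), and the question is
  only what the mean does to a function \<open>h = H\<^sub>f\<close> with \<open>h 0 = 1\<close> whose values lie in a half-plane
  that has \<open>\<beta>\<close> on its boundary.

  By the Harnack inequality (\<open>Harnack_lower_bound\<close>), the distance of \<open>h (t z)\<close> from the boundary is at
  least \<open>(1 - t r) / (1 + t r)\<close> times that of \<open>h 0\<close>, where \<open>r = norm z\<close>.  With \<open>I\<close> the mean of
  \<open>(1 - t) / (1 + t)\<close>, the mean of \<open>h\<close> therefore lies in the parallel half-plane through
  \<open>\<beta> + (1 - \<beta>) I\<close>, and strictly inside since \<open>r < 1\<close> and \<open>lam\<close> is not concentrated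
  at 0 (\<open>Harnack_mean_less\<close>, \<open>mean_op_class_W_local\<close>).  The equation that defines \<open>\<beta>\<close>
  says exactly \<open>\<beta> + (1 - \<beta>) I = \<xi>\<close>.

  For sharpness, take for \<open>h\<close> the function that attains the Harnack bound on a radius; it is
  \<open>H\<^sub>f\<close> for some \<open>g\<close> because the multipliers of the coefficients are at least 1 (\<open>H_lin_surj\<close>).
  For a parameter smaller than \<open>\<beta>\<close> its mean takes real values on both sides of \<open>\<xi>\<close>
  (\<open>extremal_class_W_local\<close>).

  What remains is to move between \<open>f\<close> and \<open>g\<close> (\<open>class_W_iff\<close>, \<open>root_in_class_W\<close>).  There the
  quotients in \<open>H\<^sub>f\<close> have to be controlled at the zeros of \<open>f\<close> and its derivative, and the principal powers
  near the origin have to be matched with their continuations to the disk.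
\<close>

section \<open>The defining expression as a linear operator\<close>

definition euler_op :: "(complex \<Rightarrow> complex) \<Rightarrow> complex \<Rightarrow> complex" where
  "euler_op g z = z * deriv g z"

text \<open>
  This is \<open>(1 + \<mu> \<theta> / \<delta>) (1 + \<nu> \<theta> / \<delta>) g\<close> for the Euler operator \<open>\<theta>\<close> and \<open>\<mu> + \<nu> = \<alpha> - \<gamma>\<close>, \<open>\<mu> * \<nu> = \<gamma>\<close>.
\<close>

definition H_lin :: "real \<Rightarrow> real \<Rightarrow> real \<Rightarrow> (complex \<Rightarrow> complex) \<Rightarrow> complex \<Rightarrow> complex" where
  "H_lin \<alpha> \<gamma> \<delta> g z =
     g z + of_real ((\<alpha> - \<gamma>) / \<delta>) * euler_op g z
         + of_real (\<gamma> / \<delta>\<^sup>2) * euler_op (euler_op g) z"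

lemma holomorphic_euler_op:
  assumes "open S" "g holomorphic_on S"
  shows "euler_op g holomorphic_on S"
  using assms unfolding euler_op_def [abs_def] by (intro holomorphic_intros)

lemma holomorphic_H_lin:
  assumes "open S" "g holomorphic_on S"
  shows "H_lin \<alpha> \<gamma> \<delta> g holomorphic_on S"
  using assms unfolding H_lin_def [abs_def]
  by (intro holomorphic_intros holomorphic_euler_op)

lemma H_lin_cong:
  assumes "open S" "g holomorphic_on S" "\<And>w. w \<in> S \<Longrightarrow> g w = k w" "z \<in> S"
  shows "H_lin \<alpha> \<gamma> \<delta> g z = H_lin \<alpha> \<gamma> \<delta> k z"
proof -
  have k: "k holomorphic_on S"
    using assms(2,3) by (simp cong: holomorphic_cong)
  have 1: "euler_op g w = euler_op k w" if "w \<in> S" for w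
    using complex_derivative_transform_within_open[OF assms(2) k assms(1) that assms(3)]
    by (simp add: euler_op_def)
  have "euler_op (euler_op g) z = euler_op (euler_op k) z"
    unfolding euler_op_def [of "euler_op g"] euler_op_def [of "euler_op k"]
    using complex_derivative_transform_within_open[OF holomorphic_euler_op[OF assms(1,2)]
       holomorphic_euler_op[OF assms(1) k] assms(1,4) 1] by simp
  then show ?thesis
    using 1 assms(3,4) by (simp add: H_lin_def)
qed

lemma H_lin_at_0: "H_lin \<alpha> \<gamma> \<delta> g 0 = g 0"
  by (simp add: H_lin_def euler_op_def)

text \<open>
  The relation in the hypothesis is the logarithmic derivative of \<open>g = (f / z)\<close> to the power \<open>\<delta>\<close>,
  multiplied by the denominators.  With \<open>P = z f' / f\<close> it reads \<open>g P = g + \<theta> g / \<delta>\<close>, and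
  differentiating it once more expresses \<open>g P z f'' / f'\<close> through \<open>P\<close> and derivatives of \<open>g\<close>.  When
  both are substituted, \<open>P\<close> cancels from \<open>H_expr\<close>, and what is left is linear in \<open>g\<close>.
\<close>

lemma H_expr_eq_H_lin:
  assumes S: "open S" "z \<in> S" and f: "f holomorphic_on S" and g: "g holomorphic_on S"
    and rel: "\<And>w. w \<in> S \<Longrightarrow>
                of_real \<delta> * g w * (w * deriv f w - f w) = w * deriv g w * f w"
    and nz: "f z \<noteq> 0" "deriv f z \<noteq> 0" "z \<noteq> 0" and \<delta>: "\<delta> > 0"
  shows "H_expr \<alpha> \<gamma> \<delta> f g z = H_lin \<alpha> \<gamma> \<delta> g z"
proof -
  define d where "d = complex_of_real \<delta>"
  have d: "d \<noteq> 0" using \<delta> by (simp add: d_def)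
  define f1 where "f1 = deriv f z"
  define f2 where "f2 = deriv (deriv f) z"
  define g1 where "g1 = deriv g z"
  define g2 where "g2 = deriv (deriv g) z"
  have f': "deriv f holomorphic_on S" and g': "deriv g holomorphic_on S"
    using f g S(1) by (auto intro: holomorphic_intros)
  have Df: "(f has_field_derivative f1) (at z)" and Dg: "(g has_field_derivative g1) (at z)"
    and Df1: "(deriv f has_field_derivative f2) (at z)"
    and Dg1: "(deriv g has_field_derivative g2) (at z)"
    unfolding f1_def g1_def f2_def g2_def
    using holomorphic_derivI[OF f S] holomorphic_derivI[OF g S] holomorphic_derivI[OF f' S]
      holomorphic_derivI[OF g' S] by blast+
  have "((\<lambda>w. d * g w * (w * deriv f w - f w)) has_field_derivative
          d * g1 * (z * f1 - f z) + d * g z * (z * f2)) (at z)"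
    by (rule derivative_eq_intros Df Dg Df1 Dg1 refl | simp add: f1_def algebra_simps)+
  moreover have "((\<lambda>w. w * deriv g w * f w) has_field_derivative
          (g1 + z * g2) * f z + z * g1 * f1) (at z)"
    by (rule derivative_eq_intros Df Dg Df1 Dg1 refl | simp add: g1_def algebra_simps)+
  then have "((\<lambda>w. d * g w * (w * deriv f w - f w)) has_field_derivative
          (g1 + z * g2) * f z + z * g1 * f1) (at z)"
    by (rule has_field_derivative_transform_within_open[OF _ S]) (simp add: rel d_def)
  ultimately have rel2: "d * g1 * (z * f1 - f z) + d * g z * (z * f2) =
          (g1 + z * g2) * f z + z * g1 * f1"
    by (rule DERIV_unique)
  have Deu: "deriv (euler_op g) z = g1 + z * g2"
    unfolding euler_op_def [abs_def]
    by (rule DERIV_imp_deriv) (rule derivative_eq_intros Dg1 refl | simp add: g1_def)+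
  define P where "P = z * f1 / f z"
  define R where "R = z * f2 / f1"
  have P: "z * f1 = P * f z" and R: "z * f2 = R * f1"
    using nz by (auto simp: P_def R_def f1_def)
  \<comment> \<open>The relation and its derivative, in terms of the logarithmic derivatives \<open>P\<close> and \<open>R\<close>.\<close>
  have E1: "d * g z * P = d * g z + z * g1"
  proof -
    have "(d * g z * P) * f z = (d * g z + z * g1) * f z"
      using rel[OF S(2)] P unfolding d_def f1_def g1_def by algebra
    then show ?thesis using nz by simp
  qed
  have E2: "d * (z * g1) * (P - 1) + d * g z * (R * P) = z * g1 + z * z * g2 + z * g1 * P"
  proof -
    have "(d * (z * g1) * (P - 1) + d * g z * (R * P)) * f z
        = (z * g1 + z * z * g2 + z * g1 * P) * f z"
      using rel2 P R by algebra
    then show ?thesis using nz by simp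
  qed
  have "d * d * (g z * P * ((d - 1) * P + (1 + R))) =
        d * (d * d * g z + 2 * d * (z * g1) + (z * g1 + z * z * g2))"
    using E1 E2 by algebra
  then have "g z * P * ((1 - 1 / d) * P + 1 / d * (1 + R)) =
        g z + 2 * (z * g1) / d + (z * g1 + z * z * g2) / d\<^sup>2"
    using d by (simp add: field_simps power2_eq_square)
  moreover have "g z * P = g z + z * g1 / d"
    using E1 d by (simp add: field_simps)
  moreover have "H_expr \<alpha> \<gamma> \<delta> f g z = of_real (1 - \<alpha> + 2 * \<gamma>) * g z
     + of_real (\<alpha> - 3 * \<gamma>) * (g z * P)
     + of_real \<gamma> * (g z * P * ((1 - 1 / d) * P + 1 / d * (1 + R)))"
  proof -
    have "z * deriv f z / f z = P" "z * (deriv ^^ 2) f z / deriv f z = R"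
      by (simp_all add: P_def R_def f1_def f2_def numeral_2_eq_2)
    moreover have "complex_of_real (1 - 1 / \<delta>) = 1 - 1 / d" "complex_of_real (1 / \<delta>) = 1 / d"
      by (simp_all add: d_def)
    ultimately show ?thesis
      unfolding H_expr_def by (simp only:) (simp only: algebra_simps)
  qed
  ultimately have "H_expr \<alpha> \<gamma> \<delta> f g z = of_real (1 - \<alpha> + 2 * \<gamma>) * g z
     + of_real (\<alpha> - 3 * \<gamma>) * (g z + z * g1 / d)
     + of_real \<gamma> * (g z + 2 * (z * g1) / d + (z * g1 + z * z * g2) / d\<^sup>2)"
    by simp
  also have "\<dots> = H_lin \<alpha> \<gamma> \<delta> g z"
    unfolding H_lin_def euler_op_def[of "euler_op g"] Deu
    using d by (simp add: euler_op_def g1_def d_def [symmetric] field_simps power2_eq_square)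
  finally show ?thesis .
qed

section \<open>Powers near the origin\<close>

lemma eq_on_disk_of_eventually_eq:
  assumes "p holomorphic_on unit_disk" "q holomorphic_on unit_disk"
    and ev: "\<forall>\<^sub>F z in at 0. p z = q z" and z: "z \<in> unit_disk"
  shows "p z = q z"
proof -
  obtain e where e: "e > 0" "\<And>z. z \<noteq> 0 \<Longrightarrow> dist z 0 < e \<Longrightarrow> p z = q z"
    using ev by (auto simp: eventually_at)
  define U where "U = ball (0::complex) (min e 1) - {0}"
  have "of_real (min e 1 / 2) \<in> U" using e(1) by (auto simp: U_def)
  then have "U \<noteq> {}" by blast
  moreover have "open U" "U \<subseteq> unit_disk" "\<And>w. w \<in> U \<Longrightarrow> p w = q w"
    using e(2) by (auto simp: U_def dist_commute)
  ultimately show ?thesis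
    using assms by (intro analytic_continuation_open[of U unit_disk p q z]) auto
qed

lemma tendsto_value_at_0:
  assumes "h holomorphic_on unit_disk"
  shows "(h \<longlongrightarrow> h 0) (at 0)"
  using assms by (metis centre_in_ball continuous_on_interior holomorphic_on_imp_continuous_on
        interior_open isContD open_ball zero_less_one)

lemma is_power_fun_power: "has_power s h \<Longrightarrow> is_power s h (fun_power s h)"
  using someI_ex[of "is_power s h"] by (simp add: has_power_def fun_power_def)

lemma is_power_unique:
  assumes "is_power s h p" "is_power s h q" "z \<in> unit_disk"
  shows "p z = q z"
proof -
  have "\<forall>\<^sub>F z in at 0. p z = q z"
    using assms(1,2) unfolding is_power_def by (auto elim: eventually_elim2)
  with assms show ?thesis
    by (intro eq_on_disk_of_eventually_eq[of p q]) (auto simp: is_power_def)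
qed

text \<open>
  The bases \<open>f z / z\<close> have the junk value 0 at the origin, so the value of the power there
  has to be found as a limit.
\<close>

lemma is_power_at_0:
  assumes "is_power s h p" "(h \<longlongrightarrow> 1) (at 0)"
  shows "p 0 = 1"
proof -
  have "((\<lambda>z. h z powr of_real s) \<longlongrightarrow> 1 powr of_real s) (at 0)"
    by (intro tendsto_intros assms) auto
  then have "(p \<longlongrightarrow> 1) (at 0)"
    using assms(1) unfolding is_power_def by (auto simp: tendsto_cong)
  then show ?thesis
    using tendsto_value_at_0[of p] assms(1) unfolding is_power_def
    by (metis at_neq_bot tendsto_unique)
qed

text \<open>
  For principal values the law of iterated powers needs \<open>s * Ln (h z)\<close> to have a small imaginary
  part; near a point where \<open>h\<close> tends to 1 it does.
\<close>

lemma eventually_powr_powr: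
  assumes "(h \<longlongrightarrow> (1::complex)) F"
  shows "\<forall>\<^sub>F z in F. (h z powr of_real s) powr of_real t = h z powr of_real (s * t)"
proof -
  have "((\<lambda>z. of_real s * Ln (h z)) \<longlongrightarrow> of_real s * Ln 1) F"
    by (intro tendsto_intros assms) auto
  then have "\<forall>\<^sub>F z in F. dist (of_real s * Ln (h z)) 0 < 1"
    by (intro tendstoD) auto
  moreover have "\<forall>\<^sub>F z in F. h z \<noteq> 0"
    using assms by (rule tendsto_imp_eventually_ne) simp
  ultimately show ?thesis
  proof eventually_elim
    case (elim z)
    have "\<bar>Im (of_real s * Ln (h z))\<bar> < 1"
      using elim(1) abs_Im_le_cmod[of "of_real s * Ln (h z)"] by (simp add: dist_norm)
    then have "Ln (exp (of_real s * Ln (h z))) = of_real s * Ln (h z)"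
      using pi_gt3 by (intro Ln_exp) auto
    then show ?case
      using elim(2) by (simp add: powr_def mult_ac)
  qed
qed

lemma tendsto_quotient_at_0:
  assumes "(f has_field_derivative 1) (at 0)" "f 0 = 0"
  shows "((\<lambda>z. f z / z) \<longlongrightarrow> (1::complex)) (at 0)"
  using assms by (simp add: has_field_derivative_iff)

text \<open>
  The identity \<open>\<theta> g / g = \<delta> (\<theta> f / f - 1)\<close> is multiplied out so that it makes sense, and can be
  continued analytically, across the zeros of \<open>f\<close> and \<open>g\<close>.
\<close>

lemma log_deriv_power_relation:
  assumes S: "open S" "w \<in> S" "0 \<notin> S" and f: "f holomorphic_on S"
    and g: "\<And>v. v \<in> S \<Longrightarrow> g v = (f v / v) powr of_real \<delta>"
    and w: "f w / w \<notin> \<real>\<^sub>\<le>\<^sub>0"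
  shows "of_real \<delta> * g w * (w * deriv f w - f w) = w * deriv g w * f w"
proof -
  have w0: "w \<noteq> 0" "f w \<noteq> 0" using S w by auto
  note Df = holomorphic_derivI[OF f S(1,2)]
  have D: "((\<lambda>v. f v / v) has_field_derivative (deriv f w * w - f w) / (w * w)) (at w)"
    using w0 by (auto intro!: derivative_eq_intros Df)
  have "((\<lambda>v. (f v / v) powr of_real \<delta>) has_field_derivative
         of_real \<delta> * (f w / w) powr (of_real \<delta> - 1) * ((deriv f w * w - f w) / (w * w))) (at w)"
    using DERIV_chain2[OF has_field_derivative_powr[OF w] D] by simp
  then have "(g has_field_derivative
         of_real \<delta> * (f w / w) powr (of_real \<delta> - 1) * ((deriv f w * w - f w) / (w * w))) (at w)"
    by (rule has_field_derivative_transform_within_open[OF _ S(1,2)]) (simp add: g)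
  then have "deriv g w =
         of_real \<delta> * (f w / w) powr (of_real \<delta> - 1) * ((deriv f w * w - f w) / (w * w))"
    by (rule DERIV_imp_deriv)
  moreover have "(f w / w) powr (of_real \<delta> - 1) = g w / (f w / w)"
    using w0 S by (simp add: g powr_diff)
  ultimately have "w * (of_real \<delta> * g w * (w * deriv f w - f w)) = w * (w * deriv g w * f w)"
    using w0 by (simp add: field_simps)
  then show ?thesis
    using w0 by simp
qed

section \<open>Taylor coefficients\<close>

text \<open>
  Both \<open>H_lin\<close> and the averaging operator act diagonally on Taylor coefficients.  Coefficients with
  respect to the powers of \<open>z\<close> make this visible, and with it that the two operators commute.
\<close>

definition has_coeffs :: "(nat \<Rightarrow> complex) \<Rightarrow> (complex \<Rightarrow> complex) \<Rightarrow> bool" where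
  "has_coeffs b g \<longleftrightarrow> (\<forall>z\<in>unit_disk. (\<lambda>n. b n * z ^ n) sums g z)"

lemma has_coeffs_of_holomorphic:
  assumes "g holomorphic_on unit_disk"
  obtains b where "has_coeffs b g"
  using holomorphic_power_series[OF assms] that[of "\<lambda>n. (deriv ^^ n) g 0 / fact n"]
  by (simp add: has_coeffs_def)

lemma has_coeffs_imp_holomorphic: "has_coeffs b g \<Longrightarrow> g holomorphic_on unit_disk"
  by (rule power_series_holomorphic[where a = b]) (simp add: has_coeffs_def)

lemma has_coeffs_unique: "has_coeffs b g \<Longrightarrow> has_coeffs b k \<Longrightarrow> z \<in> unit_disk \<Longrightarrow> g z = k z"
  unfolding has_coeffs_def using sums_unique2 by blast

text \<open>
  A power series converges absolutely strictly inside a disk of convergence, here that of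
  radius \<open>(1 + norm z) / 2\<close>.
\<close>

lemma has_coeffs_summable_norm:
  assumes "has_coeffs b g" "z \<in> unit_disk"
  shows "summable (\<lambda>n. norm (b n * z ^ n))"
proof (rule powser_insidea)
  have "of_real ((1 + norm z) / 2) \<in> unit_disk"
    unfolding mem_ball dist_0_norm norm_of_real using assms(2) by simp
  then show "summable (\<lambda>n. b n * (of_real ((1 + norm z) / 2)) ^ n)"
    using assms(1) sums_summable unfolding has_coeffs_def by blast
  show "norm z < norm (complex_of_real ((1 + norm z) / 2))"
    unfolding norm_of_real using assms(2) by simp
qed

lemma has_coeffs_add:
  "has_coeffs b g \<Longrightarrow> has_coeffs c k \<Longrightarrow> has_coeffs (\<lambda>n. b n + c n) (\<lambda>z. g z + k z)"
  unfolding has_coeffs_def by (auto simp: distrib_right intro!: sums_add)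

lemma has_coeffs_cmult:
  "has_coeffs b g \<Longrightarrow> has_coeffs (\<lambda>n. a * b n) (\<lambda>z. a * g z)"
  unfolding has_coeffs_def by (auto simp: mult.assoc intro!: sums_mult)

lemma has_coeffs_euler_op:
  assumes "has_coeffs b g"
  shows "has_coeffs (\<lambda>n. of_nat n * b n) (euler_op g)"
  unfolding has_coeffs_def
proof
  fix z assume z: "z \<in> unit_disk"
  define r where "r = (1 + norm z) / 2"
  have r: "of_real r \<in> unit_disk" "norm z < r"
    unfolding mem_ball dist_0_norm norm_of_real using z by (auto simp: r_def)
  then have "summable (\<lambda>n. b n * of_real r ^ n)"
    using assms sums_summable unfolding has_coeffs_def by blast
  then obtain k k' where k: "\<And>u. norm u < r \<Longrightarrow> (\<lambda>n. b n * u ^ n) sums k u \<and>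
      (\<lambda>n. of_nat n * b n * u ^ (n - 1)) sums k' u \<and> (k has_field_derivative k' u) (at u)"
    using power_series_and_derivative_0[of b r] by auto
  have kg: "k u = g u" if "u \<in> ball 0 r \<inter> unit_disk" for u
  proof (rule sums_unique2)
    show "(\<lambda>n. b n * u ^ n) sums k u" using k[of u] that by simp
    show "(\<lambda>n. b n * u ^ n) sums g u" using assms that by (simp add: has_coeffs_def)
  qed
  have "(g has_field_derivative k' z) (at z)"
  proof (rule has_field_derivative_transform_within_open[OF _ _ _ kg])
    show "(k has_field_derivative k' z) (at z)" using k[OF r(2)] by blast
    show "z \<in> ball 0 r \<inter> unit_disk" using r(2) z by simp
  qed auto
  then have "deriv g z = k' z" by (rule DERIV_imp_deriv)
  moreover have "(\<lambda>n. z * (of_nat n * b n * z ^ (n - 1))) sums (z * k' z)"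
    using k[OF r(2)] by (intro sums_mult) blast
  moreover have "z * (of_nat n * b n * z ^ (n - 1)) = of_nat n * b n * z ^ n" for n
    by (cases n) auto
  ultimately show "(\<lambda>n. of_nat n * b n * z ^ n) sums euler_op g z"
    by (simp only: euler_op_def)
qed

definition H_coeff :: "real \<Rightarrow> real \<Rightarrow> real \<Rightarrow> nat \<Rightarrow> real" where
  "H_coeff \<alpha> \<gamma> \<delta> n = 1 + (\<alpha> - \<gamma>) / \<delta> * real n + \<gamma> / \<delta>\<^sup>2 * (real n)\<^sup>2"

lemma H_coeff_ge_1:
  assumes "\<gamma> \<ge> 0" "\<alpha> \<ge> \<gamma>" "\<delta> > 0"
  shows "H_coeff \<alpha> \<gamma> \<delta> n \<ge> 1"
  using assms by (simp add: H_coeff_def)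

lemma has_coeffs_H_lin:
  assumes "has_coeffs b g"
  shows "has_coeffs (\<lambda>n. of_real (H_coeff \<alpha> \<gamma> \<delta> n) * b n) (H_lin \<alpha> \<gamma> \<delta> g)"
proof -
  define p q where "p = complex_of_real ((\<alpha> - \<gamma>) / \<delta>)" and "q = complex_of_real (\<gamma> / \<delta>\<^sup>2)"
  note 1 = has_coeffs_euler_op[OF assms]
  note 2 = has_coeffs_euler_op[OF 1]
  have "H_lin \<alpha> \<gamma> \<delta> g = (\<lambda>z. g z + p * euler_op g z + q * euler_op (euler_op g) z)"
    by (simp add: fun_eq_iff H_lin_def p_def q_def)
  moreover have "of_real (H_coeff \<alpha> \<gamma> \<delta> n) = 1 + p * of_nat n + q * (of_nat n)\<^sup>2" for n
    by (simp add: H_coeff_def p_def q_def)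
  then have "(\<lambda>n. of_real (H_coeff \<alpha> \<gamma> \<delta> n) * b n) =
      (\<lambda>n. b n + p * (of_nat n * b n) + q * (of_nat n * (of_nat n * b n)))"
    by (simp add: fun_eq_iff distrib_right power2_eq_square mult.assoc)
  ultimately show ?thesis
    using has_coeffs_add[OF has_coeffs_add[OF assms has_coeffs_cmult[OF 1, of p]]
        has_coeffs_cmult[OF 2, of q]] by (simp only:)
qed

text \<open>
  The eigenvalues of \<open>H_lin\<close> are at least 1, so dividing the coefficients of \<open>h\<close> by them does
  not spoil convergence.
\<close>

lemma H_lin_surj:
  assumes "h holomorphic_on unit_disk" "\<gamma> \<ge> 0" "\<alpha> \<ge> \<gamma>" "\<delta> > 0"
  obtains g where "g holomorphic_on unit_disk" "g 0 = h 0"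
    "\<And>z. z \<in> unit_disk \<Longrightarrow> H_lin \<alpha> \<gamma> \<delta> g z = h z"
proof -
  obtain b where b: "has_coeffs b h" using has_coeffs_of_holomorphic[OF assms(1)] by blast
  define c where "c n = b n / of_real (H_coeff \<alpha> \<gamma> \<delta> n)" for n
  have H: "H_coeff \<alpha> \<gamma> \<delta> n \<ge> 1" for n by (rule H_coeff_ge_1[OF assms(2-)])
  define g where "g z = (\<Sum>n. c n * z ^ n)" for z
  have "summable (\<lambda>n. c n * z ^ n)" if "z \<in> unit_disk" for z
  proof (rule summable_comparison_test'[OF has_coeffs_summable_norm[OF b that]])
    fix n
    have "norm (b n * z ^ n) / H_coeff \<alpha> \<gamma> \<delta> n \<le> norm (b n * z ^ n) / 1"
      using H[of n] by (intro divide_left_mono) auto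
    then show "norm (c n * z ^ n) \<le> norm (b n * z ^ n)"
      using H[of n] by (simp add: c_def norm_mult norm_divide)
  qed
  then have g: "has_coeffs c g"
    unfolding has_coeffs_def g_def using summable_sums by blast
  have "of_real (H_coeff \<alpha> \<gamma> \<delta> n) * c n = b n" for n
    using H[of n] by (auto simp: c_def)
  then have "has_coeffs b (H_lin \<alpha> \<gamma> \<delta> g)"
    using has_coeffs_H_lin[OF g, of \<alpha> \<gamma> \<delta>] by simp
  then have Hg: "H_lin \<alpha> \<gamma> \<delta> g z = h z" if "z \<in> unit_disk" for z
    using b that by (rule has_coeffs_unique)
  show thesis
  proof (rule that[of g])
    show "g 0 = h 0" using Hg[of 0] by (simp add: H_lin_at_0)
  qed (use Hg has_coeffs_imp_holomorphic[OF g] in auto)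
qed

section \<open>Functions with positive real part\<close>

text \<open>
  The Moebius map \<open>v \<mapsto> (v - a) / (v + cnj a)\<close> with \<open>a = u 0\<close> takes the right half-plane to the
  unit disk and \<open>a\<close> to 0, so the Schwarz lemma bounds the image \<open>W\<close> of \<open>u z\<close> by \<open>norm z\<close>.
  Solving for \<open>u z\<close> gives \<open>Re (u z) = Re a * (1 - (norm W)\<^sup>2) / (norm (1 - W))\<^sup>2\<close>.
\<close>

lemma Harnack_lower_bound:
  assumes u: "u holomorphic_on unit_disk" and pos: "\<And>z. z \<in> unit_disk \<Longrightarrow> Re (u z) > 0"
    and z: "z \<in> unit_disk"
  shows "Re (u z) \<ge> Re (u 0) * ((1 - norm z) / (1 + norm z))"
proof -
  define a where "a = u 0"
  have a: "Re a > 0" using pos[of 0] by (simp add: a_def)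
  define w where "w v = (u v - a) / (u v + cnj a)" for v
  have nz: "u v + cnj a \<noteq> 0" if "v \<in> unit_disk" for v
    using pos[OF that] a by (auto simp: complex_eq_iff)
  have "w holomorphic_on unit_disk"
    unfolding w_def [abs_def] using u nz by (intro holomorphic_intros) auto
  moreover have "w 0 = 0" by (simp add: w_def a_def)
  moreover have "norm (w v) < 1" if "norm v < 1" for v
  proof -
    have v: "v \<in> unit_disk" using that by simp
    have "(norm (u v + cnj a))\<^sup>2 - (norm (u v - a))\<^sup>2 = 4 * Re (u v) * Re a"
      unfolding cmod_power2 by (simp add: power2_eq_square algebra_simps)
    moreover have "4 * Re (u v) * Re a > 0" using pos[OF v] a by simp
    ultimately have "(norm (u v - a))\<^sup>2 < (norm (u v + cnj a))\<^sup>2" by linarith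
    then have "norm (u v - a) < norm (u v + cnj a)"
      by (rule power2_less_imp_less) simp
    then show ?thesis
      using nz[OF v] by (simp add: w_def norm_divide divide_simps)
  qed
  ultimately have wz: "norm (w z) \<le> norm z"
    using Schwarz_Lemma(1)[of w z] z by simp
  define W where "W = w z"
  have W1: "norm W < 1" using wz z by (simp add: W_def)
  have "W * (u z + cnj a) = u z - a"
    using nz[OF z] by (simp add: W_def w_def)
  then have "u z * (1 - W) = a + cnj a * W" by (simp add: algebra_simps)
  moreover have W2: "1 - W \<noteq> 0" using W1 by auto
  ultimately have "u z = (a + cnj a * W) / (1 - W)" by (simp add: field_simps)
  also have "\<dots> = (a + cnj a * W) * cnj (1 - W) / of_real ((norm (1 - W))\<^sup>2)"
    by (subst complex_div_cnj) (rule refl)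
  finally have "Re (u z) = Re ((a + cnj a * W) * cnj (1 - W)) / (norm (1 - W))\<^sup>2"
    by (simp only: Re_divide_of_real)
  also have "Re ((a + cnj a * W) * cnj (1 - W)) = Re a * (1 - (norm W)\<^sup>2)"
    unfolding cmod_power2 by (simp add: power2_eq_square algebra_simps)
  finally have eq: "Re (u z) = Re a * (1 - (norm W)\<^sup>2) / (norm (1 - W))\<^sup>2" .
  define x where "x = norm W"
  have x: "0 \<le> x" "x < 1" "x \<le> norm z" using W1 wz by (auto simp: x_def W_def)
  have "norm (1 - W) \<le> 1 + x"
    using norm_triangle_ineq4[of 1 W] by (simp add: x_def)
  then have le: "(norm (1 - W))\<^sup>2 \<le> (1 + x)\<^sup>2" by (intro power_mono) auto
  have fac: "1 - x\<^sup>2 = (1 - x) * (1 + x)"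
    by (simp add: power2_eq_square algebra_simps)
  have "Re a * ((1 - norm z) / (1 + norm z)) \<le> Re a * ((1 - x) / (1 + x))"
    using x a z by (intro mult_left_mono frac_le) auto
  also have "\<dots> = Re a * (1 - x\<^sup>2) / (1 + x)\<^sup>2"
    using x(1) unfolding fac by (simp add: power2_eq_square)
  also have "\<dots> \<le> Re a * (1 - x\<^sup>2) / (norm (1 - W))\<^sup>2"
  proof (rule divide_left_mono[OF le])
    show "0 \<le> Re a * (1 - x\<^sup>2)" unfolding fac using a x by simp
    show "0 < (1 + x)\<^sup>2 * (norm (1 - W))\<^sup>2"
      using x W2 by (intro mult_pos_pos zero_less_power) auto
  qed
  finally show ?thesis unfolding eq x_def a_def .
qed

lemma Harnack_ratio_diff:
  fixes r t :: real
  assumes "1 + r * t \<noteq> 0" "1 + t \<noteq> 0"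
  shows "(1 - r * t) / (1 + r * t) - (1 - t) / (1 + t) = 2 * ((1 - r) * t) / ((1 + t) * (1 + r * t))"
proof -
  have "(1 - r * t) * (1 + t) - (1 - t) * (1 + r * t) = 2 * ((1 - r) * t)"
    by (simp add: algebra_simps)
  then show ?thesis
    using diff_frac_eq[OF assms, of "1 - r * t" "1 - t"] by (simp only: mult.commute)
qed

section \<open>Averaging along radii\<close>

locale prob_weight =
  fixes lam :: "real \<Rightarrow> real"
  assumes nonneg: "\<And>t. t \<in> {0..1} \<Longrightarrow> lam t \<ge> 0"
    and abs_integrable: "lam absolutely_integrable_on {0..1}"
    and integral_1: "integral {0..1} lam = 1"
begin

lemma integrable_scaleR:
  fixes u :: "real \<Rightarrow> 'a :: euclidean_space"
  assumes "continuous_on {0..1} u"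
  shows "(\<lambda>t. lam t *\<^sub>R u t) integrable_on {0..1}"
proof -
  have "(\<lambda>t. lam t *\<^sub>R u t) absolutely_integrable_on {0..1}"
  proof (rule absolutely_integrable_bounded_measurable_product[where h = "\<lambda>x c. c *\<^sub>R x", OF _ _ _ _ abs_integrable])
    show "bilinear (\<lambda>(x :: 'a) c. c *\<^sub>R x)"
      by (simp add: bilinear_conv_bounded_bilinear bounded_bilinear.flip bounded_bilinear_scaleR)
    show "u \<in> borel_measurable (lebesgue_on {0..1})"
      using assms by (intro continuous_imp_measurable_on_sets_lebesgue) auto
    show "bounded (u ` {0..1})"
      using assms by (intro compact_imp_bounded compact_continuous_image) auto
  qed auto
  then show ?thesis by (simp add: absolutely_integrable_on_def)
qed

lemma integrable_mult:
  "continuous_on {0..1} u \<Longrightarrow> (\<lambda>t. lam t * u t) integrable_on {0..1}"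
  using integrable_scaleR[of u] by simp

lemma integrable_complex_mult:
  "continuous_on {0..1} u \<Longrightarrow> (\<lambda>t. complex_of_real (lam t) * u t) integrable_on {0..1}"
  using integrable_scaleR[of u] by (simp add: scaleR_conv_of_real)

lemma integral_mono:
  assumes "continuous_on {0..1} u" "continuous_on {0..1} v" "\<And>t. t \<in> {0..1} \<Longrightarrow> u t \<le> v t"
  shows "integral {0..1} (\<lambda>t. lam t * u t) \<le> integral {0..1} (\<lambda>t. lam t * v t)"
  using assms nonneg by (intro integral_le integrable_mult mult_left_mono) auto

lemma integral_add_cmult:
  assumes "continuous_on {0..1} u" "continuous_on {0..1} v"
  shows "integral {0..1} (\<lambda>t. lam t * (u t + c * v t)) =
           integral {0..1} (\<lambda>t. lam t * u t) + c * integral {0..1} (\<lambda>t. lam t * v t)"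
proof -
  have "((\<lambda>t. lam t * u t + c * (lam t * v t)) has_integral
      integral {0..1} (\<lambda>t. lam t * u t) + c * integral {0..1} (\<lambda>t. lam t * v t)) {0..1}"
    by (intro has_integral_add has_integral_mult_right integrable_integral integrable_mult assms)
  moreover have "(\<lambda>t. lam t * (u t + c * v t)) = (\<lambda>t. lam t * u t + c * (lam t * v t))"
    by (simp add: fun_eq_iff algebra_simps)
  ultimately show ?thesis by (simp only: integral_unique)
qed

lemma integral_add_const:
  assumes "continuous_on {0..1} u"
  shows "integral {0..1} (\<lambda>t. lam t * (u t + c)) = integral {0..1} (\<lambda>t. lam t * u t) + c"
  using integral_add_cmult[OF assms continuous_on_const, of c 1] integral_1 by simp

text \<open>
  The mass of \<open>lam\<close> on \<open>{0..e}\<close> tends to 0 with \<open>e\<close>; hence for some \<open>e > 0\<close> more than half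
  of the mass lies on \<open>{e..1}\<close>, where \<open>t \<ge> e\<close>.
\<close>

lemma first_moment_pos: "integral {0..1} (\<lambda>t. lam t * t) > 0"
proof -
  have int: "lam integrable_on {0..1}" using abs_integrable by (simp add: absolutely_integrable_on_def)
  have "continuous_on {0..1} (\<lambda>x. integral {0..x} lam)"
    by (rule indefinite_integral_continuous_1[OF int])
  then obtain d where d: "d > 0" "\<And>x. x \<in> {0..1} \<Longrightarrow> dist x 0 < d \<Longrightarrow>
      dist (integral {0..x} lam) (integral {0..0} lam) < 1/2"
    unfolding continuous_on_iff by (metis atLeastAtMost_iff half_gt_zero less_eq_real_def zero_less_one)
  define e where "e = min (d/2) 1"
  have e: "0 < e" "e \<le> 1" "e < d" using d(1) by (auto simp: e_def)
  have "integral {0..e} lam < 1/2"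
    using d(2)[of e] e by (simp add: dist_norm)
  moreover have "integral {0..e} lam + integral {e..1} lam = integral {0..1} lam"
    using Henstock_Kurzweil_Integration.integral_combine[OF _ _ int] e by simp
  ultimately have "integral {e..1} lam > 1/2" using integral_1 by simp
  have int_t: "(\<lambda>t. lam t * t) integrable_on {0..1}" by (intro integrable_mult continuous_intros)
  have sub: "{e..1} \<subseteq> {0..1}" using e by auto
  have "0 < e * (1/2)" using e by simp
  also have "\<dots> < e * integral {e..1} lam"
    using e \<open>integral {e..1} lam > 1/2\<close> by (intro mult_strict_left_mono)
  also have "\<dots> = integral {e..1} (\<lambda>t. lam t * e)" by (simp add: mult.commute)
  also have "\<dots> \<le> integral {e..1} (\<lambda>t. lam t * t)"
    using e nonneg sub
    by (intro integral_le integrable_on_mult_left mult_left_mono integrable_subinterval_real[OF int_t] integrable_subinterval_real[OF int]) auto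
  also have "\<dots> \<le> integral {0..1} (\<lambda>t. lam t * t)"
    using e nonneg sub
    by (intro integral_subset_le integrable_subinterval_real[OF int_t] int_t) auto
  finally show ?thesis .
qed

text \<open>
  The Harnack bound along the segment from 0 to \<open>z\<close>, averaged; \<open>r\<close> is \<open>norm z\<close>.  The value at
  \<open>r = 1\<close> is the constant that determines \<open>\<beta>\<close>.
\<close>

definition Harnack_mean :: "real \<Rightarrow> real" where
  "Harnack_mean r = integral {0..1} (\<lambda>t. lam t * ((1 - r * t) / (1 + r * t)))"

lemma continuous_Harnack:
  assumes "0 \<le> r"
  shows "continuous_on {0..1} (\<lambda>t::real. (1 - r * t) / (1 + r * t))"
  using assms by (intro continuous_intros) (auto simp: add_nonneg_eq_0_iff)

lemma integral_affine_Harnack: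
  assumes "0 \<le> r"
  shows "integral {0..1} (\<lambda>t. lam t * (a * ((1 - r * t) / (1 + r * t)) + b)) = a * Harnack_mean r + b"
proof -
  have "(\<lambda>t. lam t * (a * ((1 - r * t) / (1 + r * t)))) =
      (\<lambda>t. a * (lam t * ((1 - r * t) / (1 + r * t))))"
    by (simp only: mult.left_commute)
  then show ?thesis
    unfolding Harnack_mean_def integral_mult_right [symmetric]
      integral_add_const[OF continuous_on_mult_left[OF continuous_Harnack[OF assms]]]
    by (simp only:)
qed

text \<open>
  The strictness is what turns the limiting case \<open>norm z = 1\<close> into a strict inequality in the
  open disk.  The difference of the integrands is at least \<open>(1 - r) / 2 * t\<close>, which has a
  positive mean.
\<close>

lemma Harnack_mean_less:
  assumes "0 \<le> r" "r < 1"
  shows "Harnack_mean 1 < Harnack_mean r"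
proof -
  have *: "(1 - t) / (1 + t) + (1 - r) / 2 * t \<le> (1 - r * t) / (1 + r * t)" if "t \<in> {0..1}" for t
  proof -
    have p: "1 + t > 0" "1 + r * t > 0" using that assms by (auto intro: add_pos_nonneg)
    have "r * t \<le> 1" using that assms by (auto intro: mult_le_one)
    then have le: "(1 + t) * (1 + r * t) \<le> 2 * 2" using that assms by (intro mult_mono) auto
    define Y where "Y = (1 - r) * t"
    have "0 \<le> Y" using that assms by (simp add: Y_def)
    from mult_left_mono[OF le this]
    have "Y / 2 * ((1 + t) * (1 + r * t)) \<le> 2 * Y" by simp
    then have "Y / 2 \<le> 2 * Y / ((1 + t) * (1 + r * t))"
      using p by (simp only: pos_le_divide_eq mult_pos_pos)
    also have "\<dots> = (1 - r * t) / (1 + r * t) - (1 - t) / (1 + t)"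
      unfolding Y_def using p by (intro Harnack_ratio_diff[symmetric]) auto
    finally have "Y / 2 \<le> (1 - r * t) / (1 + r * t) - (1 - t) / (1 + t)" .
    moreover have "(1 - r) / 2 * t = Y / 2" by (simp add: Y_def)
    ultimately show ?thesis by linarith
  qed
  have c: "continuous_on {0..1} (\<lambda>t::real. (1 - t) / (1 + t))"
    using continuous_Harnack[of 1] by simp
  have "Harnack_mean 1 < Harnack_mean 1 + (1 - r) / 2 * integral {0..1} (\<lambda>t. lam t * t)"
    using first_moment_pos assms by simp
  also have "\<dots> = integral {0..1} (\<lambda>t. lam t * ((1 - t) / (1 + t) + (1 - r) / 2 * t))"
    unfolding Harnack_mean_def mult_1_left by (intro integral_add_cmult[symmetric] c continuous_on_id)
  also have "\<dots> \<le> Harnack_mean r"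
    unfolding Harnack_mean_def using *
    by (intro integral_mono continuous_Harnack assms continuous_on_add[OF c] continuous_intros) auto
  finally show ?thesis .
qed

text \<open>
  Together with the strict lower bound this shows that \<open>Harnack_mean r\<close> tends to
  \<open>Harnack_mean 1\<close> as \<open>r\<close> tends to 1.
\<close>

lemma Harnack_mean_le:
  assumes "0 \<le> r" "r \<le> 1"
  shows "Harnack_mean r \<le> Harnack_mean 1 + 2 * (1 - r)"
proof -
  have *: "(1 - r * t) / (1 + r * t) \<le> (1 - t) / (1 + t) + 2 * (1 - r)" if "t \<in> {0..1}" for t
  proof -
    have p: "1 + t > 0" "1 + r * t > 0" using that assms by (auto intro: add_pos_nonneg)
    have "1 * 1 \<le> (1 + t) * (1 + r * t)" using that assms by (intro mult_mono) auto
    have "(1 - r * t) / (1 + r * t) - (1 - t) / (1 + t) = 2 * ((1 - r) * t) / ((1 + t) * (1 + r * t))"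
      using p by (intro Harnack_ratio_diff) auto
    also have "\<dots> \<le> 2 * ((1 - r) * 1) / (1 * 1)"
      using p that assms \<open>1 * 1 \<le> _\<close> by (intro frac_le mult_left_mono) auto
    finally show ?thesis by linarith
  qed
  have c: "continuous_on {0..1} (\<lambda>t::real. (1 - t) / (1 + t))"
    using continuous_Harnack[of 1] by simp
  have "Harnack_mean r \<le> integral {0..1} (\<lambda>t. lam t * ((1 - t) / (1 + t) + 2 * (1 - r)))"
    unfolding Harnack_mean_def using *
    by (intro integral_mono continuous_Harnack assms continuous_on_add[OF c] continuous_intros) auto
  also have "\<dots> = Harnack_mean 1 + 2 * (1 - r)"
    unfolding integral_add_const[OF c] by (simp add: Harnack_mean_def)
  finally show ?thesis .
qed

lemma Harnack_mean_1_bounds: "0 \<le> Harnack_mean 1" "Harnack_mean 1 < 1"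
proof -
  show "0 \<le> Harnack_mean 1"
    unfolding Harnack_mean_def using nonneg
    by (intro integral_nonneg integrable_mult continuous_Harnack) auto
  show "Harnack_mean 1 < 1"
    using Harnack_mean_less[of 0] integral_1 by (simp add: Harnack_mean_def)
qed

lemma ray_in_disk:
  assumes "t \<in> {0..1}" "z \<in> unit_disk"
  shows "complex_of_real t * z \<in> unit_disk"
proof -
  have "t * norm z \<le> norm z" using assms(1) by (simp add: mult_left_le_one_le)
  moreover have "norm (complex_of_real t * z) = t * norm z" using assms(1) by (simp add: norm_mult)
  ultimately show ?thesis using assms(2) by simp
qed

lemma continuous_on_ray:
  assumes "u holomorphic_on unit_disk" "z \<in> unit_disk"
  shows "continuous_on {0..1} (\<lambda>t. u (of_real t * z))"
proof -
  have "continuous_on {0..1} (\<lambda>t. complex_of_real t * z)" by (intro continuous_intros)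
  then show ?thesis
    using ray_in_disk[OF _ assms(2)]
    by (intro continuous_on_compose2[OF holomorphic_on_imp_continuous_on[OF assms(1)]]) auto
qed

text \<open>
  The partial sums of the series for \<open>g (t z)\<close> are bounded, uniformly in \<open>t\<close>, by the
  sum of the absolute values at \<open>z\<close>, so dominated convergence permits integration term by term.
\<close>

lemma has_coeffs_mean_op:
  assumes "has_coeffs b g"
  shows "has_coeffs (\<lambda>n. of_real (integral {0..1} (\<lambda>t. lam t * t ^ n)) * b n) (mean_op lam g)"
  unfolding has_coeffs_def
proof
  fix z assume z: "z \<in> unit_disk"
  define M where "M = (\<Sum>n. norm (b n * z ^ n))"
  define F where "F N t = complex_of_real (lam t) * (\<Sum>n<N. b n * (of_real t * z) ^ n)" for N t
  have term_int: "(\<lambda>t. lam t * t ^ n) integrable_on {0..1}" for n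
    by (intro integrable_mult continuous_intros)
  have termC: "((\<lambda>t. complex_of_real (lam t * t ^ n) * (b n * z ^ n)) has_integral
          of_real (integral {0..1} (\<lambda>t. lam t * t ^ n)) * (b n * z ^ n)) {0..1}" for n
    by (intro has_integral_mult_left has_integral_linear[OF integrable_integral[OF term_int] bounded_linear_of_real, unfolded o_def])
  have F_eq: "F N = (\<lambda>t. \<Sum>n<N. complex_of_real (lam t * t ^ n) * (b n * z ^ n))" for N
    by (auto simp: F_def sum_distrib_left power_mult_distrib mult_ac)
  have F_int: "(F N has_integral (\<Sum>n<N. of_real (integral {0..1} (\<lambda>t. lam t * t ^ n)) * (b n * z ^ n))) {0..1}" for N
    unfolding F_eq by (intro has_integral_sum termC) auto
  have "(\<lambda>N. integral {0..1} (F N)) \<longlonglongrightarrow> integral {0..1} (\<lambda>t. of_real (lam t) * g (of_real t * z))"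
  proof (rule dominated_convergence(2))
    show "F N integrable_on {0..1}" for N using F_int by blast
    show "(\<lambda>t. lam t * M) integrable_on {0..1}" by (intro integrable_mult continuous_intros)
    fix t :: real assume t: "t \<in> {0..1}"
    show "norm (F N t) \<le> lam t * M" for N
    proof -
      have "norm (\<Sum>n<N. b n * (of_real t * z) ^ n) \<le> (\<Sum>n<N. norm (b n * z ^ n))"
      proof (rule sum_norm_le)
        fix n
        have "t ^ n * norm (b n * z ^ n) \<le> 1 * norm (b n * z ^ n)"
          using t by (intro mult_right_mono power_le_one) auto
        then show "norm (b n * (of_real t * z) ^ n) \<le> norm (b n * z ^ n)"
          using t by (simp add: norm_mult norm_power power_mult_distrib mult_ac)
      qed
      also have "\<dots> \<le> M"
        unfolding M_def by (intro sum_le_suminf has_coeffs_summable_norm[OF assms z]) auto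
      finally show ?thesis
        using nonneg[OF t] by (simp add: F_def norm_mult mult_left_mono)
    qed
    have "(\<lambda>n. b n * (of_real t * z) ^ n) sums g (of_real t * z)"
      using assms ray_in_disk[OF t z] by (simp only: has_coeffs_def)
    then show "(\<lambda>N. F N t) \<longlonglongrightarrow> of_real (lam t) * g (of_real t * z)"
      unfolding sums_def F_def by (rule tendsto_mult_left)
  qed
  then show "(\<lambda>n. of_real (integral {0..1} (\<lambda>t. lam t * t ^ n)) * b n * z ^ n) sums mean_op lam g z"
    using integral_unique[OF F_int] by (simp add: sums_def mean_op_def mult.assoc)
qed

lemma holomorphic_mean_op:
  "g holomorphic_on unit_disk \<Longrightarrow> mean_op lam g holomorphic_on unit_disk"
  by (rule has_coeffs_of_holomorphic) (blast intro: has_coeffs_imp_holomorphic has_coeffs_mean_op)+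

lemma mean_op_at_0: "mean_op lam g 0 = g 0"
proof -
  have "(lam has_integral 1) {0..1}"
    using abs_integrable integral_1 by (metis absolutely_integrable_on_def integrable_integral)
  from has_integral_linear[OF this bounded_linear_of_real[where 'a = complex]]
  have "((\<lambda>t. complex_of_real (lam t) * g 0) has_integral (1 * g 0)) {0..1}"
    by (intro has_integral_mult_left) (simp add: o_def)
  from integral_unique[OF this] show ?thesis
    by (simp only: mean_op_def mult_zero_right mult_1_left)
qed

lemma mean_op_cong:
  assumes "\<And>w. w \<in> unit_disk \<Longrightarrow> g w = k w" "z \<in> unit_disk"
  shows "mean_op lam g z = mean_op lam k z"
  unfolding mean_op_def
proof (rule integral_cong)
  show "of_real (lam t) * g (of_real t * z) = of_real (lam t) * k (of_real t * z)"
    if "t \<in> {0..1}" for t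
    using assms(1)[OF ray_in_disk[OF that assms(2)]] by simp
qed

lemma H_lin_mean_op:
  assumes "g holomorphic_on unit_disk" "z \<in> unit_disk"
  shows "H_lin \<alpha> \<gamma> \<delta> (mean_op lam g) z = mean_op lam (H_lin \<alpha> \<gamma> \<delta> g) z"
proof -
  obtain b where b: "has_coeffs b g" using has_coeffs_of_holomorphic[OF assms(1)] by blast
  show ?thesis
    using has_coeffs_H_lin[OF has_coeffs_mean_op[OF b], of \<alpha> \<gamma> \<delta>]
      has_coeffs_mean_op[OF has_coeffs_H_lin[OF b, of \<alpha> \<gamma> \<delta>]] assms(2)
    by (intro has_coeffs_unique) (simp_all add: mult_ac)
qed

lemma Re_mean_op:
  assumes "h holomorphic_on unit_disk" "z \<in> unit_disk"
  shows "Re (c * mean_op lam h z) = integral {0..1} (\<lambda>t. lam t * Re (c * h (of_real t * z)))"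
proof -
  have "bounded_linear (\<lambda>x. Re (c * x))"
    by (intro bounded_linear_compose[OF bounded_linear_Re] bounded_linear_mult_right)
  from integral_linear[OF integrable_complex_mult[OF continuous_on_ray[OF assms]] this]
  have "Re (c * mean_op lam h z) =
      integral {0..1} (\<lambda>t. Re (c * (of_real (lam t) * h (of_real t * z))))"
    by (simp add: mean_op_def o_def)
  also have "(\<lambda>t. Re (c * (of_real (lam t) * h (of_real t * z)))) =
      (\<lambda>t. lam t * Re (c * h (of_real t * z)))"
    by (auto simp: algebra_simps)
  finally show ?thesis .
qed

end

section \<open>From functions to their powers\<close>

lemma class_A_iff:
  "f \<in> class_A \<longleftrightarrow> f holomorphic_on unit_disk \<and> f 0 = 0 \<and> (f has_field_derivative 1) (at 0)"
  unfolding class_A_def using holomorphic_derivI[of f unit_disk 0] DERIV_imp_deriv[of f 1 0] by auto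

text \<open>
  The quotient \<open>f z / z\<close> tends to 1, hence avoids the cut of the principal power near the origin.
\<close>

lemma eventually_power_relation:
  assumes r: "r > 0" and f: "f holomorphic_on ball 0 r" and lim: "((\<lambda>z. f z / z) \<longlongrightarrow> 1) (at 0)"
    and g: "\<forall>\<^sub>F z in at 0. g z = (f z / z) powr of_real \<delta>"
  shows "\<forall>\<^sub>F w in at 0. of_real \<delta> * g w * (w * deriv f w - f w) = w * deriv g w * f w"
proof -
  have "\<forall>\<^sub>F z in at 0. f z / z \<in> - \<real>\<^sub>\<le>\<^sub>0"
    by (rule topological_tendstoD[OF lim]) (auto simp: open_Compl)
  moreover have "\<forall>\<^sub>F z in at (0::complex). z \<in> ball 0 r"
    using r by (intro eventually_at_in_open') auto
  ultimately have "\<forall>\<^sub>F z in at 0. g z = (f z / z) powr of_real \<delta> \<and> f z / z \<notin> \<real>\<^sub>\<le>\<^sub>0 \<and> z \<in> ball 0 r"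
    using g by eventually_elim auto
  then obtain e where e: "e > 0" "\<And>z. z \<noteq> 0 \<Longrightarrow> dist z 0 < e \<Longrightarrow>
      g z = (f z / z) powr of_real \<delta> \<and> f z / z \<notin> \<real>\<^sub>\<le>\<^sub>0 \<and> z \<in> ball 0 r"
    by (auto simp: eventually_at)
  define S where "S = ball (0::complex) e - {0}"
  have S: "open S" "0 \<notin> S" "\<And>z. z \<in> S \<Longrightarrow>
      g z = (f z / z) powr of_real \<delta> \<and> f z / z \<notin> \<real>\<^sub>\<le>\<^sub>0 \<and> z \<in> ball 0 r"
    using e by (auto simp: S_def dist_commute)
  have "f holomorphic_on S"
    using S(3) by (intro holomorphic_on_subset[OF f]) auto
  then have "of_real \<delta> * g w * (w * deriv f w - f w) = w * deriv g w * f w" if "w \<in> S" for w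
    using S that by (intro log_deriv_power_relation[of S]) auto
  then show ?thesis
    using e(1) by (auto simp: eventually_at S_def dist_commute intro!: exI[of _ e])
qed

text \<open>
  Away from the origin \<open>f z / z\<close> is the principal root of \<open>g\<close>, whose power \<open>\<delta>\<close> is \<open>g\<close> again
  near the origin.
\<close>

lemma H_expr_local:
  assumes \<delta>: "\<delta> > 0" and g: "g holomorphic_on unit_disk" "g 0 = 1"
  shows "\<forall>\<^sub>F z in at 0. H_expr \<alpha> \<gamma> \<delta> (\<lambda>w. w * g w powr of_real (1 / \<delta>)) g z = H_lin \<alpha> \<gamma> \<delta> g z"
proof -
  define f where "f w = w * g w powr of_real (1 / \<delta>)" for w
  have g_lim: "(g \<longlongrightarrow> 1) (at 0)" using tendsto_value_at_0[OF g(1)] g(2) by simp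
  then have "\<forall>\<^sub>F z in at 0. g z \<in> - \<real>\<^sub>\<le>\<^sub>0"
    by (rule topological_tendstoD) (auto simp: open_Compl)
  then obtain r0 where r0: "r0 > 0" "\<And>z. z \<noteq> 0 \<Longrightarrow> dist z 0 < r0 \<Longrightarrow> g z \<notin> \<real>\<^sub>\<le>\<^sub>0"
    by (auto simp: eventually_at)
  define r where "r = min r0 1"
  have r: "r > 0" "ball 0 r \<subseteq> unit_disk" using r0(1) by (auto simp: r_def)
  have gr: "g z \<notin> \<real>\<^sub>\<le>\<^sub>0" if "z \<in> ball 0 r" for z
    using that r0(2)[of z] g(2) by (cases "z = 0") (auto simp: r_def)
  have g_hol: "g holomorphic_on ball 0 r" using g(1) r(2) by (rule holomorphic_on_subset)
  have f: "f holomorphic_on ball 0 r"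
    unfolding f_def [abs_def] using g_hol gr by (intro holomorphic_intros) auto
  have "((\<lambda>z. g z powr of_real (1 / \<delta>)) \<longlongrightarrow> 1 powr of_real (1 / \<delta>)) (at 0)"
    by (intro tendsto_intros g_lim) auto
  then have "((\<lambda>z. f z / z) \<longlongrightarrow> 1 powr of_real (1 / \<delta>)) (at 0)"
    by (rule Lim_transform_eventually) (auto simp: f_def eventually_at intro!: exI[of _ 1])
  then have f_lim: "((\<lambda>z. f z / z) \<longlongrightarrow> 1) (at 0)" by simp
  have "\<forall>\<^sub>F z in at 0. (g z powr of_real (1 / \<delta>)) powr of_real \<delta> = g z powr of_real (1 / \<delta> * \<delta>)"
    by (rule eventually_powr_powr[OF g_lim])
  moreover have "\<forall>\<^sub>F z in at 0. g z \<noteq> 0" by (rule tendsto_imp_eventually_ne[OF g_lim]) simp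
  moreover have "\<forall>\<^sub>F z in at (0::complex). z \<noteq> 0" by (auto simp: eventually_at_filter)
  ultimately have "\<forall>\<^sub>F z in at 0. g z = (f z / z) powr of_real \<delta>"
    by eventually_elim (use \<delta> in \<open>simp add: f_def\<close>)
  note rel = eventually_power_relation[OF r(1) f f_lim this]
  have "(f has_field_derivative 1) (at 0)"
    using f_lim by (simp add: has_field_derivative_iff f_def)
  then have "deriv f 0 = 1" by (rule DERIV_imp_deriv)
  moreover have "deriv f holomorphic_on ball 0 r" using f by (intro holomorphic_intros) auto
  then have "isCont (deriv f) 0"
    using r(1) by (metis centre_in_ball continuous_on_interior holomorphic_on_imp_continuous_on
        interior_open open_ball)
  ultimately have "(deriv f \<longlongrightarrow> 1) (at 0)" by (simp add: isCont_def)
  then have "\<forall>\<^sub>F z in at 0. deriv f z \<noteq> 0" by (rule tendsto_imp_eventually_ne) simp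
  moreover have "\<forall>\<^sub>F z in at 0. f z / z \<noteq> 0" by (rule tendsto_imp_eventually_ne[OF f_lim]) simp
  moreover have "\<forall>\<^sub>F z in at (0::complex). z \<in> ball 0 r"
    using r(1) by (intro eventually_at_in_open') auto
  ultimately have "\<forall>\<^sub>F z in at 0. (of_real \<delta> * g z * (z * deriv f z - f z) = z * deriv g z * f z)
      \<and> deriv f z \<noteq> 0 \<and> f z \<noteq> 0 \<and> z \<in> ball 0 r"
    using rel by eventually_elim auto
  then obtain e where e: "e > 0" "\<And>z. z \<noteq> 0 \<Longrightarrow> dist z 0 < e \<Longrightarrow>
      (of_real \<delta> * g z * (z * deriv f z - f z) = z * deriv g z * f z)
      \<and> deriv f z \<noteq> 0 \<and> f z \<noteq> 0 \<and> z \<in> ball 0 r"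
    by (auto simp: eventually_at)
  define S where "S = ball (0::complex) e - {0}"
  have "open S" by (simp add: S_def open_delete)
  have Se: "(of_real \<delta> * g z * (z * deriv f z - f z) = z * deriv g z * f z)
      \<and> deriv f z \<noteq> 0 \<and> f z \<noteq> 0 \<and> z \<in> ball 0 r" if "z \<in> S" for z
    using e(2)[of z] that unfolding S_def by (simp add: dist_commute)
  then have "S \<subseteq> ball 0 r" by blast
  note hol_S = holomorphic_on_subset[OF f this] holomorphic_on_subset[OF g_hol this]
  have "0 \<notin> S" by (simp add: S_def)
  have "H_expr \<alpha> \<gamma> \<delta> f g z = H_lin \<alpha> \<gamma> \<delta> g z" if "z \<in> S" for z
    using Se that \<open>0 \<notin> S\<close>
    by (intro H_expr_eq_H_lin[OF \<open>open S\<close> that hol_S _ _ _ _ \<delta>]) auto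
  then show ?thesis
    using e(1) unfolding f_def [abs_def]
    by (auto simp: eventually_at S_def dist_commute intro!: exI[of _ e])
qed

text \<open>
  The relation between \<open>f\<close> and \<open>g\<close> holds near the origin and therefore on the whole disk.  Zeros of
  \<open>f\<close> and of its derivative are isolated, so the quotients in \<open>H_expr\<close> make sense in a punctured
  neighbourhood of every point of the disk, and there \<open>H_expr\<close> agrees with a continuous function.
\<close>

lemma remove_sings_H_expr:
  assumes \<delta>: "\<delta> > 0" and f: "f \<in> class_A" and g: "is_power \<delta> (\<lambda>z. f z / z) g"
    and z: "z \<in> unit_disk"
  shows "remove_sings (H_expr \<alpha> \<gamma> \<delta> f g) z = H_lin \<alpha> \<gamma> \<delta> g z"
proof -
  have f_hol: "f holomorphic_on unit_disk" and f0: "f 0 = 0"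
    and Df: "(f has_field_derivative 1) (at 0)"
    using f by (auto simp: class_A_iff)
  have g_hol: "g holomorphic_on unit_disk" using g by (simp add: is_power_def)
  have f': "deriv f holomorphic_on unit_disk" and g': "deriv g holomorphic_on unit_disk"
    using f_hol g_hol by (auto intro: holomorphic_intros)
  have "\<forall>\<^sub>F w in at 0. of_real \<delta> * g w * (w * deriv f w - f w) = w * deriv g w * f w"
    using g by (intro eventually_power_relation[of 1] f_hol tendsto_quotient_at_0[OF Df f0])
      (auto simp: is_power_def)
  then have rel: "of_real \<delta> * g w * (w * deriv f w - f w) = w * deriv g w * f w"
    if "w \<in> unit_disk" for w
    using f_hol g_hol f' g' that
    by (intro eq_on_disk_of_eventually_eq[of "\<lambda>w. of_real \<delta> * g w * (w * deriv f w - f w)"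
          "\<lambda>w. w * deriv g w * f w"]) (auto intro!: holomorphic_intros)
  have "deriv f 0 \<noteq> 0" using DERIV_imp_deriv[OF Df] by simp
  then have ev1: "\<forall>\<^sub>F w in at z. deriv f w \<noteq> 0 \<and> w \<in> unit_disk"
    using z by (intro non_zero_neighbour_alt[OF f', of z 0]) auto
  have "\<exists>b\<in>unit_disk. f b \<noteq> 0"
  proof (rule ccontr)
    assume "\<not> ?thesis"
    then have "((\<lambda>w. 0) has_field_derivative 1) (at (0::complex))"
      by (intro has_field_derivative_transform_within_open[OF Df, of unit_disk]) auto
    moreover have "((\<lambda>w. 0) has_field_derivative 0) (at (0::complex))" by simp
    ultimately show False using DERIV_unique zero_neq_one by metis
  qed
  then obtain b where b: "b \<in> unit_disk" "f b \<noteq> 0" by blast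
  then have ev2: "\<forall>\<^sub>F w in at z. f w \<noteq> 0 \<and> w \<in> unit_disk"
    using z by (intro non_zero_neighbour_alt[OF f_hol, of z b]) auto
  have "\<forall>\<^sub>F w in at z. H_lin \<alpha> \<gamma> \<delta> g w = H_expr \<alpha> \<gamma> \<delta> f g w"
    using ev1 ev2
  proof eventually_elim
    case (elim w)
    then have "w \<noteq> 0" using f0 by auto
    then show ?case
      using elim \<delta> rel by (intro H_expr_eq_H_lin[symmetric, of unit_disk] f_hol g_hol) auto
  qed
  moreover have "isCont (H_lin \<alpha> \<gamma> \<delta> g) z"
    using z holomorphic_on_imp_continuous_on[OF holomorphic_H_lin[OF open_ball g_hol]]
    by (metis continuous_on_interior interior_open open_ball)
  ultimately have "H_expr \<alpha> \<gamma> \<delta> f g \<midarrow>z\<rightarrow> H_lin \<alpha> \<gamma> \<delta> g z"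
    unfolding isCont_def by (rule Lim_transform_eventually[rotated])
  then show ?thesis by (rule remove_sings_eqI)
qed

text \<open>
  The continuation \<open>h\<close> is unique, and \<open>H_lin \<alpha> \<gamma> \<delta> g\<close> is one.
\<close>

lemma class_W_local_iff:
  assumes "\<delta> > 0"
  shows "g \<in> class_W_local \<alpha> \<gamma> \<delta> \<beta> \<longleftrightarrow> g holomorphic_on unit_disk \<and> g 0 = 1 \<and>
    (\<exists>\<phi>::real. \<forall>z\<in>unit_disk. Re (exp (\<i> * of_real \<phi>) * (H_lin \<alpha> \<gamma> \<delta> g z - of_real \<beta>)) > 0)"
proof (cases "g holomorphic_on unit_disk \<and> g 0 = 1")
  case True
  define F where "F = H_expr \<alpha> \<gamma> \<delta> (\<lambda>w. w * g w powr of_real (1 / \<delta>)) g"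
  have ev: "\<forall>\<^sub>F z in at 0. F z = H_lin \<alpha> \<gamma> \<delta> g z"
    unfolding F_def using H_expr_local[OF assms] True by blast
  have hol: "H_lin \<alpha> \<gamma> \<delta> g holomorphic_on unit_disk"
    using True by (intro holomorphic_H_lin) auto
  have unique: "h z = H_lin \<alpha> \<gamma> \<delta> g z"
    if "h holomorphic_on unit_disk" "\<forall>\<^sub>F z in at 0. h z = F z" "z \<in> unit_disk" for h z
    using eventually_elim2[OF that(2) ev] that(1,3) hol
    by (intro eq_on_disk_of_eventually_eq[of h]) auto
  have ev': "\<forall>\<^sub>F z in at 0. H_lin \<alpha> \<gamma> \<delta> g z = F z"
    using ev by eventually_elim simp
  have "(\<exists>h. h holomorphic_on unit_disk \<and> (\<forall>\<^sub>F z in at 0. h z = F z) \<and>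
      (\<exists>\<phi>::real. \<forall>z\<in>unit_disk. Re (exp (\<i> * of_real \<phi>) * (h z - of_real \<beta>)) > 0)) \<longleftrightarrow>
      (\<exists>\<phi>::real. \<forall>z\<in>unit_disk. Re (exp (\<i> * of_real \<phi>) * (H_lin \<alpha> \<gamma> \<delta> g z - of_real \<beta>)) > 0)"
    (is "?L \<longleftrightarrow> ?R")
  proof
    assume ?L
    then obtain h \<phi> where h: "h holomorphic_on unit_disk" "\<forall>\<^sub>F z in at 0. h z = F z" and
      \<phi>: "\<forall>z\<in>unit_disk. Re (exp (\<i> * of_real \<phi>) * (h z - of_real \<beta>)) > 0"
      by blast
    have "\<forall>z\<in>unit_disk. Re (exp (\<i> * of_real \<phi>) * (H_lin \<alpha> \<gamma> \<delta> g z - of_real \<beta>)) > 0"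
      using \<phi> unique[OF h] by (metis (no_types, lifting))
    then show ?R ..
  next
    assume ?R
    with hol ev' show ?L by blast
  qed
  then show ?thesis
    unfolding class_W_local_def mem_Collect_eq F_def [symmetric] using True by blast
qed (auto simp: class_W_local_def)

lemma class_W_local_cong:
  assumes "\<delta> > 0" "\<And>z. z \<in> unit_disk \<Longrightarrow> g z = k z" "g \<in> class_W_local \<alpha> \<gamma> \<delta> \<beta>"
  shows "k \<in> class_W_local \<alpha> \<gamma> \<delta> \<beta>"
proof -
  have g: "g holomorphic_on unit_disk" "g 0 = 1" using assms class_W_local_iff by blast+
  have "k holomorphic_on unit_disk" by (rule holomorphic_transform[OF g(1) assms(2)])
  moreover have "k 0 = 1" using g(2) assms(2)[of 0] by simp
  moreover have "H_lin \<alpha> \<gamma> \<delta> g z = H_lin \<alpha> \<gamma> \<delta> k z" if "z \<in> unit_disk" for z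
    using H_lin_cong[OF open_ball g(1) assms(2) that] .
  ultimately show ?thesis
    using assms(3) by (simp add: class_W_local_iff[OF assms(1)])
qed

lemma class_W_iff:
  assumes "\<delta> > 0"
  shows "f \<in> class_W \<alpha> \<gamma> \<delta> \<beta> \<longleftrightarrow> f \<in> class_A \<and> has_power \<delta> (\<lambda>z. f z / z) \<and>
           fun_power \<delta> (\<lambda>z. f z / z) \<in> class_W_local \<alpha> \<gamma> \<delta> \<beta>"
proof (cases "f \<in> class_A \<and> has_power \<delta> (\<lambda>z. f z / z)")
  case True
  define g where "g = fun_power \<delta> (\<lambda>z. f z / z)"
  have g: "is_power \<delta> (\<lambda>z. f z / z) g"
    unfolding g_def using True by (intro is_power_fun_power) auto
  then have "g holomorphic_on unit_disk" "g 0 = 1"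
    using True by (auto simp: is_power_def class_A_iff
        intro!: is_power_at_0[OF g] tendsto_quotient_at_0)
  moreover have "H_fun \<alpha> \<gamma> \<delta> f z = H_lin \<alpha> \<gamma> \<delta> g z" if "z \<in> unit_disk" for z
    using remove_sings_H_expr[OF assms _ g that] True by (simp add: H_fun_def g_def)
  ultimately show ?thesis
    using True unfolding class_W_def g_def [symmetric] class_W_local_iff[OF assms] by simp
qed (auto simp: class_W_def)

text \<open>
  The inverse passage, from \<open>g\<close> back to \<open>f\<close>, is possible as soon as the root of \<open>g\<close> extends
  to the disk.
\<close>

lemma root_in_class_W:
  assumes \<delta>: "\<delta> > 0" and g: "g \<in> class_W_local \<alpha> \<gamma> \<delta> \<beta>" and p: "has_power (1 / \<delta>) g"
  defines "f \<equiv> \<lambda>z. z * fun_power (1 / \<delta>) g z"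
  shows "f \<in> class_W \<alpha> \<gamma> \<delta> \<beta>"
    and "\<And>z. z \<in> unit_disk \<Longrightarrow> fun_power \<delta> (\<lambda>z. f z / z) z = g z"
proof -
  define k where "k = fun_power (1 / \<delta>) g"
  have g': "g holomorphic_on unit_disk" "g 0 = 1"
    using g class_W_local_iff[OF \<delta>] by blast+
  have g_lim: "(g \<longlongrightarrow> 1) (at 0)" using tendsto_value_at_0[OF g'(1)] g'(2) by simp
  have k: "is_power (1 / \<delta>) g k" unfolding k_def using p by (rule is_power_fun_power)
  then have k_hol: "k holomorphic_on unit_disk" by (simp add: is_power_def)
  have k0: "k 0 = 1" by (rule is_power_at_0[OF k g_lim])
  have f: "f = (\<lambda>z. z * k z)" by (simp add: f_def k_def)
  have "(k \<longlongrightarrow> 1) (at 0)" using tendsto_value_at_0[OF k_hol] k0 by simp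
  then have "((\<lambda>z. f z / z) \<longlongrightarrow> 1) (at 0)"
    by (rule Lim_transform_eventually) (auto simp: f eventually_at intro!: exI[of _ 1])
  then have fA: "f \<in> class_A"
    using k_hol by (auto simp: class_A_iff has_field_derivative_iff f intro!: holomorphic_intros)
  have "\<forall>\<^sub>F z in at 0. (g z powr of_real (1 / \<delta>)) powr of_real \<delta> = g z powr of_real (1 / \<delta> * \<delta>)"
    by (rule eventually_powr_powr[OF g_lim])
  moreover have "\<forall>\<^sub>F z in at 0. g z \<noteq> 0" by (rule tendsto_imp_eventually_ne[OF g_lim]) simp
  moreover have "\<forall>\<^sub>F z in at (0::complex). z \<noteq> 0" by (auto simp: eventually_at_filter)
  moreover have "\<forall>\<^sub>F z in at 0. k z = g z powr of_real (1 / \<delta>)"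
    using k by (simp add: is_power_def)
  ultimately have "\<forall>\<^sub>F z in at 0. g z = (f z / z) powr of_real \<delta>"
    by eventually_elim (use \<delta> in \<open>simp add: f\<close>)
  then have gp: "is_power \<delta> (\<lambda>z. f z / z) g"
    using g'(1) by (simp add: is_power_def)
  then have hp: "has_power \<delta> (\<lambda>z. f z / z)" by (auto simp: has_power_def)
  show eq: "fun_power \<delta> (\<lambda>z. f z / z) z = g z" if "z \<in> unit_disk" for z
    using is_power_fun_power[OF hp] gp that by (rule is_power_unique)
  show "f \<in> class_W \<alpha> \<gamma> \<delta> \<beta>"
    unfolding class_W_iff[OF \<delta>] using fA hp class_W_local_cong[OF \<delta> _ g] eq by metis
qed

text \<open>
  At the origin the condition says \<open>(1 - \<beta>) * cos \<phi> > 0\<close>: the rotated half-plane contains the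
  positive real direction.
\<close>

lemma class_W_local_angle:
  assumes "\<beta> < 1" "g 0 = 1" "Re (exp (\<i> * of_real \<phi>) * (H_lin \<alpha> \<gamma> \<delta> g 0 - of_real \<beta>)) > 0"
  shows "cos \<phi> > 0"
  using assms by (simp add: H_lin_at_0 exp_Euler cos_of_real sin_of_real zero_less_mult_iff)

lemma class_W_local_mono:
  assumes "\<delta> > 0" "\<beta>' \<le> \<beta>" "\<beta> < 1"
  shows "class_W_local \<alpha> \<gamma> \<delta> \<beta> \<subseteq> class_W_local \<alpha> \<gamma> \<delta> \<beta>'"
proof
  fix g assume g: "g \<in> class_W_local \<alpha> \<gamma> \<delta> \<beta>"
  then obtain \<phi> where g': "g holomorphic_on unit_disk" "g 0 = 1" and
    \<phi>: "\<And>z. z\<in>unit_disk \<Longrightarrow> Re (exp (\<i> * of_real \<phi>) * (H_lin \<alpha> \<gamma> \<delta> g z - of_real \<beta>)) > 0"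
    unfolding class_W_local_iff[OF assms(1)] by blast
  have "cos \<phi> > 0" using class_W_local_angle[OF assms(3) g'(2) \<phi>] by simp
  then have "(\<beta> - \<beta>') * cos \<phi> \<ge> 0" using assms(2) by simp
  moreover have "Re (exp (\<i> * of_real \<phi>) * (H_lin \<alpha> \<gamma> \<delta> g z - of_real \<beta>')) =
     Re (exp (\<i> * of_real \<phi>) * (H_lin \<alpha> \<gamma> \<delta> g z - of_real \<beta>)) + (\<beta> - \<beta>') * cos \<phi>" for z
    by (simp add: exp_Euler cos_of_real sin_of_real algebra_simps)
  ultimately show "g \<in> class_W_local \<alpha> \<gamma> \<delta> \<beta>'"
    unfolding class_W_local_iff[OF assms(1)] using g' \<phi> by (metis add_pos_nonneg)
qed

section \<open>The inclusion and its sharpness\<close>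

context prob_weight
begin

text \<open>
  The same angle \<open>\<phi>\<close> serves for \<open>g\<close> and for its mean.  The function
  \<open>u = exp (\<i> \<phi>) * (H_lin \<alpha> \<gamma> \<delta> g - \<beta>)\<close> has positive real part and \<open>Re (u 0) = (1 - \<beta>) * cos \<phi>\<close>,
  so averaging its Harnack bound over the segment from 0 to \<open>z\<close> gives
  \<open>Re (exp (\<i> \<phi>) * (mean - \<xi>)) \<ge> ((1 - \<beta>) * Harnack_mean (norm z) + \<beta> - \<xi>) * cos \<phi>\<close>.
\<close>

lemma mean_op_class_W_local:
  assumes \<delta>: "\<delta> > 0" and \<beta>: "\<beta> < 1" and \<xi>: "(1 - \<beta>) * Harnack_mean 1 + \<beta> - \<xi> \<ge> 0"
    and g: "g \<in> class_W_local \<alpha> \<gamma> \<delta> \<beta>"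
  shows "mean_op lam g \<in> class_W_local \<alpha> \<gamma> \<delta> \<xi>"
proof -
  obtain \<phi> where g': "g holomorphic_on unit_disk" "g 0 = 1" and
    \<phi>: "\<And>z. z\<in>unit_disk \<Longrightarrow> Re (exp (\<i> * of_real \<phi>) * (H_lin \<alpha> \<gamma> \<delta> g z - of_real \<beta>)) > 0"
    using g unfolding class_W_local_iff[OF \<delta>] by blast
  define c where "c = exp (\<i> * of_real \<phi>)"
  define h where "h = H_lin \<alpha> \<gamma> \<delta> g"
  have h: "h holomorphic_on unit_disk" "h 0 = 1"
    using g' by (auto simp: h_def H_lin_at_0 intro: holomorphic_H_lin)
  have cos: "cos \<phi> > 0" using class_W_local_angle[OF \<beta> g'(2) \<phi>] by simp
  have Re_c: "Re (c * of_real x) = x * cos \<phi>" for x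
    by (simp add: c_def exp_Euler cos_of_real sin_of_real)
  define u where "u z = c * (h z - of_real \<beta>)" for z
  have u: "u holomorphic_on unit_disk" unfolding u_def [abs_def] by (intro holomorphic_intros h)
  have "u 0 = c * of_real (1 - \<beta>)" by (simp add: u_def h)
  then have u0: "Re (u 0) = (1 - \<beta>) * cos \<phi>" by (simp only: Re_c)
  have "Re (c * (H_lin \<alpha> \<gamma> \<delta> (mean_op lam g) z - of_real \<xi>)) > 0" if z: "z \<in> unit_disk" for z
  proof -
    have nz: "norm z < 1" using z by simp
    have "0 \<le> ((1 - \<beta>) * Harnack_mean 1 + \<beta> - \<xi>) * cos \<phi>" using \<xi> cos by simp
    also have "\<dots> < ((1 - \<beta>) * Harnack_mean (norm z) + \<beta> - \<xi>) * cos \<phi>"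
      using Harnack_mean_less[OF norm_ge_zero nz] \<beta> cos by simp
    also have "\<dots> = integral {0..1} (\<lambda>t. lam t * (Re (u 0) * ((1 - norm z * t) / (1 + norm z * t)) + \<beta> * cos \<phi>)) - \<xi> * cos \<phi>"
      unfolding integral_affine_Harnack[OF norm_ge_zero] u0 by (simp add: algebra_simps)
    also have "\<dots> \<le> integral {0..1} (\<lambda>t. lam t * Re (c * h (of_real t * z))) - \<xi> * cos \<phi>"
    proof (intro diff_right_mono integral_mono)
      show "continuous_on {0..1} (\<lambda>t. Re (u 0) * ((1 - norm z * t) / (1 + norm z * t)) + \<beta> * cos \<phi>)"
        by (intro continuous_on_add continuous_on_mult_left continuous_Harnack continuous_on_const) auto
      show "continuous_on {0..1} (\<lambda>t. Re (c * h (of_real t * z)))"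
        by (intro continuous_intros continuous_on_ray h z)
      fix t :: real assume t: "t \<in> {0..1}"
      note tz = ray_in_disk[OF t z]
      have "Re (u (of_real t * z)) \<ge> Re (u 0) * ((1 - norm (of_real t * z)) / (1 + norm (of_real t * z)))"
        using \<phi> tz by (intro Harnack_lower_bound[OF u]) (auto simp: u_def c_def h_def)
      moreover have "norm (of_real t * z) = norm z * t" using t by (simp add: norm_mult)
      moreover have "Re (u (of_real t * z)) = Re (c * h (of_real t * z)) - \<beta> * cos \<phi>"
        unfolding u_def right_diff_distrib minus_complex.sel Re_c ..
      ultimately show "Re (u 0) * ((1 - norm z * t) / (1 + norm z * t)) + \<beta> * cos \<phi>
          \<le> Re (c * h (of_real t * z))" by simp
    qed
    also have "\<dots> = Re (c * (mean_op lam h z - of_real \<xi>))"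
      unfolding right_diff_distrib minus_complex.sel Re_c Re_mean_op[OF h(1) z] ..
    finally show ?thesis
      unfolding h_def H_lin_mean_op[OF g'(1) z] .
  qed
  then show ?thesis
    unfolding class_W_local_iff[OF \<delta>] c_def mean_op_at_0
    using holomorphic_mean_op[OF g'(1)] g'(2) by blast
qed

text \<open>
  Let \<open>H_lin \<alpha> \<gamma> \<delta> g\<close> be \<open>\<beta> + (1 - \<beta>) * (1 - z) / (1 + z)\<close>, for which the Harnack bound is attained on
  the positive radius.  There its mean is the real number \<open>(1 - \<beta>) * Harnack_mean r + \<beta>\<close>, which falls
  below \<open>\<xi>\<close> as \<open>r\<close> tends to 1, while the mean is \<open>1 > \<xi>\<close> at the origin.  No rotated half-plane
  with \<open>\<xi>\<close> on its boundary contains a real number on each side of \<open>\<xi>\<close>.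
\<close>

lemma extremal_class_W_local:
  assumes \<delta>: "\<delta> > 0" and "\<gamma> \<ge> 0" "\<alpha> \<ge> \<gamma>" and \<beta>: "\<beta> < 1" and \<xi>: "\<xi> < 1"
    and neg: "(1 - \<beta>) * Harnack_mean 1 + \<beta> - \<xi> < 0"
  shows "\<exists>g\<in>class_W_local \<alpha> \<gamma> \<delta> \<beta>. mean_op lam g \<notin> class_W_local \<alpha> \<gamma> \<delta> \<xi>"
proof -
  define h where "h z = of_real \<beta> + of_real (1 - \<beta>) * ((1 - z) / (1 + z))" for z :: complex
  have nz: "1 + z \<noteq> 0" if "z \<in> unit_disk" for z :: complex
    using that by (auto simp: add_eq_0_iff)
  have h_hol: "h holomorphic_on unit_disk"
    unfolding h_def [abs_def] using nz by (intro holomorphic_intros) auto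
  obtain g where g: "g holomorphic_on unit_disk" "g 0 = h 0"
    and gh: "\<And>z. z \<in> unit_disk \<Longrightarrow> H_lin \<alpha> \<gamma> \<delta> g z = h z"
    using H_lin_surj[OF h_hol assms(2,3,1)] by blast
  have g0: "g 0 = 1" using g(2) by (simp add: h_def)
  have "Re (exp (\<i> * of_real 0) * (H_lin \<alpha> \<gamma> \<delta> g z - of_real \<beta>)) > 0" if z: "z \<in> unit_disk" for z
  proof -
    have "(1 - z) / (1 + z) = (1 - z) * cnj (1 + z) / of_real ((norm (1 + z))\<^sup>2)"
      by (subst complex_div_cnj) (rule refl)
    then have "Re ((1 - z) / (1 + z)) = Re ((1 - z) * cnj (1 + z)) / (norm (1 + z))\<^sup>2"
      by (simp only: Re_divide_of_real)
    also have "Re ((1 - z) * cnj (1 + z)) = 1 - (norm z)\<^sup>2"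
      unfolding cmod_power2 by (simp add: power2_eq_square algebra_simps)
    also have "(1 - (norm z)\<^sup>2) / (norm (1 + z))\<^sup>2 > 0"
      using nz[OF z] z by (intro divide_pos_pos) (auto simp: power_less_one_iff abs_square_less_1)
    finally have "(1 - \<beta>) * Re ((1 - z) / (1 + z)) > 0" using \<beta> by simp
    moreover have "Re (of_real (1 - \<beta>) * ((1 - z) / (1 + z))) = (1 - \<beta>) * Re ((1 - z) / (1 + z))"
      unfolding times_complex.sel by simp
    ultimately show ?thesis
      by (simp only: gh[OF z] h_def add_diff_cancel_left' of_real_0 mult_zero_right exp_zero mult_1_left)
  qed
  then have gW: "g \<in> class_W_local \<alpha> \<gamma> \<delta> \<beta>"
    unfolding class_W_local_iff[OF \<delta>] using g(1) g0 by blast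
  define K where "K = \<xi> - ((1 - \<beta>) * Harnack_mean 1 + \<beta>)"
  \<comment> \<open>The radius \<open>r = 1 - s\<close> is so close to 1 that \<open>(1 - \<beta>) * Harnack_mean r\<close> has come
    within half of the gap \<open>K\<close> of its limit.\<close>
  define s where "s = min 1 (K / (4 * (1 - \<beta>)))"
  have K: "K > 0" using neg by (simp add: K_def)
  then have s: "0 < s" "s \<le> 1" using \<beta> by (auto simp: s_def)
  have "s \<le> K / (4 * (1 - \<beta>))" by (simp add: s_def)
  then have s2: "(1 - \<beta>) * (2 * s) \<le> K / 2" using \<beta> by (simp add: field_simps)
  define r where "r = 1 - s"
  have r: "0 \<le> r" "r < 1" using s by (auto simp: r_def)
  have rD: "complex_of_real r \<in> unit_disk" using r by simp
  define m where "m = (1 - \<beta>) * Harnack_mean r + \<beta>"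
  have "(1 - \<beta>) * Harnack_mean r \<le> (1 - \<beta>) * (Harnack_mean 1 + 2 * s)"
    using Harnack_mean_le[of r] r \<beta> by (intro mult_left_mono) (auto simp: r_def)
  then have m: "m < \<xi>" using s2 K by (simp add: m_def K_def algebra_simps)
  have "mean_op lam h (of_real r) = of_real m"
  proof -
    have "h (of_real t * of_real r) = of_real ((1 - \<beta>) * ((1 - r * t) / (1 + r * t)) + \<beta>)" for t
      by (simp add: h_def mult.commute)
    then have "mean_op lam h (of_real r) = integral {0..1}
        (\<lambda>t. complex_of_real (lam t * ((1 - \<beta>) * ((1 - r * t) / (1 + r * t)) + \<beta>)))"
      by (simp only: mean_op_def of_real_mult)
    also have "\<dots> = of_real (integral {0..1} (\<lambda>t. lam t * ((1 - \<beta>) * ((1 - r * t) / (1 + r * t)) + \<beta>)))"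
      by (intro integral_linear[OF _ bounded_linear_of_real, unfolded o_def] integrable_mult
          continuous_on_add continuous_on_mult_left continuous_Harnack r continuous_on_const)
    also have "integral {0..1} (\<lambda>t. lam t * ((1 - \<beta>) * ((1 - r * t) / (1 + r * t)) + \<beta>)) = m"
      unfolding m_def by (rule integral_affine_Harnack[OF r(1)])
    finally show ?thesis .
  qed
  moreover have "mean_op lam h (of_real r) = mean_op lam (H_lin \<alpha> \<gamma> \<delta> g) (of_real r)"
    using gh rD by (intro mean_op_cong) auto
  ultimately have Hr: "H_lin \<alpha> \<gamma> \<delta> (mean_op lam g) (of_real r) = of_real m"
    using H_lin_mean_op[OF g(1) rD] by simp
  have "mean_op lam g \<notin> class_W_local \<alpha> \<gamma> \<delta> \<xi>"
  proof
    assume "mean_op lam g \<in> class_W_local \<alpha> \<gamma> \<delta> \<xi>"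
    then obtain \<phi> where \<phi>: "\<And>z. z \<in> unit_disk \<Longrightarrow>
        Re (exp (\<i> * of_real \<phi>) * (H_lin \<alpha> \<gamma> \<delta> (mean_op lam g) z - of_real \<xi>)) > 0"
      unfolding class_W_local_iff[OF \<delta>] by blast
    have "cos \<phi> > 0"
      using class_W_local_angle[OF \<xi> _ \<phi>] g0 by (simp add: mean_op_at_0)
    moreover have "(m - \<xi>) * cos \<phi> > 0"
      using \<phi>[OF rD] unfolding Hr by (simp add: exp_Euler cos_of_real sin_of_real algebra_simps)
    ultimately show False using m by (simp add: zero_less_mult_iff)
  qed
  then show ?thesis using gW by blast
qed

end

theorem theorem2p2:
  fixes \<alpha> \<gamma> \<delta> \<mu> \<nu> \<xi> \<beta> :: real and lam :: "real \<Rightarrow> real"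
  assumes "\<alpha> \<ge> 0" and "\<gamma> \<ge> 0" and "\<delta> > 0"
    and "\<mu> \<ge> 0" and "\<nu> \<ge> 0" and "\<mu> * \<nu> = \<gamma>" and "\<mu> + \<nu> = \<alpha> - \<gamma>"
    and "\<forall>t\<in>{0..1}. lam t \<ge> 0"
    and "lam absolutely_integrable_on {0..1}"
    and "integral {0..1} lam = 1"
    and "\<xi> < 1" and "\<beta> < 1"
    and "\<beta> / (1 - \<beta>) =
           - integral {0..1} (\<lambda>t. lam t * ((1 - (1 + \<xi>) / (1 - \<xi>) * t) / (1 + t)))"
  shows
    "(\<forall>f\<in>class_W \<alpha> \<gamma> \<delta> \<beta>. V_defined lam \<delta> f \<longrightarrow> V_op lam \<delta> f \<in> class_W \<alpha> \<gamma> \<delta> \<xi>)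
     \<and> ((\<exists>\<beta>\<^sub>0<\<beta>. \<forall>g\<in>class_W_local \<alpha> \<gamma> \<delta> \<beta>\<^sub>0. has_power (1 / \<delta>) g) \<longrightarrow>
          (\<forall>\<beta>'<\<beta>. \<exists>f\<in>class_W \<alpha> \<gamma> \<delta> \<beta>'. V_defined lam \<delta> f \<and> V_op lam \<delta> f \<notin> class_W \<alpha> \<gamma> \<delta> \<xi>))
     \<and> (\<forall>g\<in>class_W_local \<alpha> \<gamma> \<delta> \<beta>. mean_op lam g \<in> class_W_local \<alpha> \<gamma> \<delta> \<xi>)
     \<and> (\<forall>\<beta>'<\<beta>. \<exists>g\<in>class_W_local \<alpha> \<gamma> \<delta> \<beta>'. mean_op lam g \<notin> class_W_local \<alpha> \<gamma> \<delta> \<xi>)"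
proof -
  note \<gamma> = \<open>\<gamma> \<ge> 0\<close> and \<delta> = \<open>\<delta> > 0\<close> and \<xi> = \<open>\<xi> < 1\<close> and \<beta> = \<open>\<beta> < 1\<close>
  have \<alpha>: "\<alpha> \<ge> \<gamma>" using assms(4,5,7) by simp
  interpret prob_weight lam
    using assms(8-10) by unfold_locales auto
  define I where "I = Harnack_mean 1"
  have I: "0 \<le> I" "I < 1" unfolding I_def by (fact Harnack_mean_1_bounds)+
  \<comment> \<open>The kernel in the definition of \<open>\<beta>\<close> is an affine function of the Harnack kernel.\<close>
  have "integral {0..1} (\<lambda>t. lam t * ((1 - (1 + \<xi>) / (1 - \<xi>) * t) / (1 + t)))
      = integral {0..1} (\<lambda>t. lam t * (1 / (1 - \<xi>) * ((1 - 1 * t) / (1 + 1 * t)) + - (\<xi> / (1 - \<xi>))))"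
  proof (intro integral_cong arg_cong2[where f = "(*)"] refl)
    fix t :: real assume "t \<in> {0..1}"
    then have "1 + t \<noteq> 0" "1 - \<xi> \<noteq> 0" using \<xi> by auto
    then show "(1 - (1 + \<xi>) / (1 - \<xi>) * t) / (1 + t) =
        1 / (1 - \<xi>) * ((1 - 1 * t) / (1 + 1 * t)) + - (\<xi> / (1 - \<xi>))"
      by (simp add: divide_simps) (simp add: algebra_simps)
  qed
  also have "\<dots> = 1 / (1 - \<xi>) * I + - (\<xi> / (1 - \<xi>))"
    unfolding I_def by (rule integral_affine_Harnack) simp
  finally have "\<beta> / (1 - \<beta>) = (\<xi> - I) / (1 - \<xi>)"
    using assms(13) by (simp add: diff_divide_distrib)
  then have "\<beta> * (1 - \<xi>) = (\<xi> - I) * (1 - \<beta>)"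
    using \<beta> \<xi> by (simp add: field_simps)
  then have key: "(1 - \<beta>) * I + \<beta> - \<xi> = 0" by (simp add: algebra_simps)
  have key_less: "(1 - b) * I + b - \<xi> < 0" if "b < \<beta>" for b
  proof -
    have "b * (1 - I) < \<beta> * (1 - I)" using that I by simp
    then show ?thesis using key by (simp add: algebra_simps)
  qed
  have mean: "mean_op lam g \<in> class_W_local \<alpha> \<gamma> \<delta> \<xi>" if "g \<in> class_W_local \<alpha> \<gamma> \<delta> \<beta>" for g
    by (rule mean_op_class_W_local[OF \<delta> \<beta> _ that]) (use key in \<open>simp add: I_def\<close>)
  have sharp: "\<exists>g\<in>class_W_local \<alpha> \<gamma> \<delta> b. mean_op lam g \<notin> class_W_local \<alpha> \<gamma> \<delta> \<xi>" if "b < \<beta>" for b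
    using that \<beta> key_less[OF that]
    by (intro extremal_class_W_local[OF \<delta> \<gamma> \<alpha> _ \<xi>]) (auto simp: I_def)
  have V: "V_op lam \<delta> f \<in> class_W \<alpha> \<gamma> \<delta> \<xi>" if f: "f \<in> class_W \<alpha> \<gamma> \<delta> \<beta>" "V_defined lam \<delta> f" for f
  proof -
    have "V_base lam \<delta> f \<in> class_W_local \<alpha> \<gamma> \<delta> \<xi>"
      using mean f(1) by (simp add: class_W_iff[OF \<delta>] V_base_def)
    then show ?thesis
      using root_in_class_W(1)[OF \<delta>] f(2) unfolding V_defined_def V_op_def [abs_def] by blast
  qed
  have "\<exists>f\<in>class_W \<alpha> \<gamma> \<delta> b. V_defined lam \<delta> f \<and> V_op lam \<delta> f \<notin> class_W \<alpha> \<gamma> \<delta> \<xi>"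
    if b0: "b0 < \<beta>" "\<And>g. g \<in> class_W_local \<alpha> \<gamma> \<delta> b0 \<Longrightarrow> has_power (1 / \<delta>) g" and b: "b < \<beta>" for b0 b
  proof -
    \<comment> \<open>An extremal function \<open>g\<close> for a parameter not below \<open>b0\<close> has the root that defines \<open>f\<close>.  Its mean lies
      in the class of the same parameter, hence has a root too.\<close>
    define c where "c = max b0 b"
    have c: "c < \<beta>" "c < 1" "b0 \<le> c" "b \<le> c" using b0(1) b \<beta> by (auto simp: c_def)
    obtain g where g: "g \<in> class_W_local \<alpha> \<gamma> \<delta> c" "mean_op lam g \<notin> class_W_local \<alpha> \<gamma> \<delta> \<xi>"
      using sharp[OF c(1)] by blast
    define f where "f = (\<lambda>z. z * fun_power (1 / \<delta>) g z)"
    have g_power: "has_power (1 / \<delta>) g"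
      using b0(2) class_W_local_mono[OF \<delta> c(3,2)] g(1) by blast
    have f: "f \<in> class_W \<alpha> \<gamma> \<delta> b"
      unfolding f_def using g(1) class_W_local_mono[OF \<delta> c(4,2)]
      by (intro root_in_class_W(1)[OF \<delta> _ g_power]) blast
    have fg: "fun_power \<delta> (\<lambda>z. f z / z) z = g z" if "z \<in> unit_disk" for z
      unfolding f_def using that by (rule root_in_class_W(2)[OF \<delta> g(1) g_power])
    have Vg: "V_base lam \<delta> f z = mean_op lam g z" if "z \<in> unit_disk" for z
      unfolding V_base_def using fg that by (intro mean_op_cong) auto
    have "mean_op lam g \<in> class_W_local \<alpha> \<gamma> \<delta> c"
      using c I by (intro mean_op_class_W_local[OF \<delta> c(2) _ g(1)]) (simp add: I_def)
    from class_W_local_cong[OF \<delta> Vg[symmetric] this]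
    have V_local: "V_base lam \<delta> f \<in> class_W_local \<alpha> \<gamma> \<delta> c"
      and defd: "V_defined lam \<delta> f"
      unfolding V_defined_def using b0(2) class_W_local_mono[OF \<delta> c(3,2)] by blast+
    have "V_op lam \<delta> f \<notin> class_W \<alpha> \<gamma> \<delta> \<xi>"
    proof
      assume "V_op lam \<delta> f \<in> class_W \<alpha> \<gamma> \<delta> \<xi>"
      then have "fun_power \<delta> (\<lambda>z. V_op lam \<delta> f z / z) \<in> class_W_local \<alpha> \<gamma> \<delta> \<xi>"
        by (simp add: class_W_iff[OF \<delta>])
      moreover have "fun_power \<delta> (\<lambda>z. V_op lam \<delta> f z / z) z = mean_op lam g z" if "z \<in> unit_disk" for z
        using root_in_class_W(2)[OF \<delta> V_local _ that] defd Vg[OF that]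
        unfolding V_defined_def V_op_def by simp
      ultimately have "mean_op lam g \<in> class_W_local \<alpha> \<gamma> \<delta> \<xi>"
        using class_W_local_cong[OF \<delta>] by blast
      then show False using g(2) by blast
    qed
    then show ?thesis using f defd by blast
  qed
  then show ?thesis using V mean sharp by blast
qed

end
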